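(* Let $f_1,f_2:\mathbb R^+\to\mathbb R^+$ be continuous and strictly increasing with $f_i(x)>0$ for $x>0$, $i=1,2$. Let $h_i:\mathbb R^+\to\mathbb R$ ($i=1,2$) be Lebesgue measurable with $h_i(t)\le t$ and $\lim_{t\to\infty}h_i(t)=\infty$. For $i=1,2$ let $R_i(t,\cdot)$ be left continuous and non-decreasing for any $t$, let $R_i(\cdot,s)$ be locally integrable for any $s$, let $R_i(t,s)=0$ for $s\le h_i(t)$ and $R_i(t,t^+)=1$, and let $r_i$ be a Lebesgue measurable essentially bounded function on $\mathbb R^+$ with $r_i(t)\ge 0$ and $\int_0^\infty r_i(s)\,ds=\infty$. Let $\varphi,\psi:(-\infty,0]\to\mathbb R$ be continuous bounded functions with $\varphi(t)\ge 0$, $\psi(t)\ge 0$ for $t<0$ and $\varphi(0)>0$, $\psi(0)>0$. Let $G_1,G_2:\mathbb R^+\to\mathbb R^+$ be continuous with $G_i(x)>0$ for $x>0$. Consider the initial value problem (PG) described in the context. 1) If $f_2(x)<f_1^{-1}(x)$ for any $x>0$, then any solution of (PG) converges to zero (both components) as $t\to\infty$. 2) If $f_2(x)>f_1^{-1}(x)$ for any $x>0$, then any global solution of (PG) (i.e. solution defined on $[0,\infty)$) tends to infinity (both components) as $t\to\infty$.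
   Context: $\mathbb R^+=[0,\infty)$; $u(t^+)$ is the right-side limit of $u$ at $t$. Problem (PG) is the system $$x'(t)=r_1(t)G_1(x(t))\left[\int_{h_1(t)}^t f_1(y(s))\,d_sR_1(t,s)-x(t)\right],\quad y'(t)=r_2(t)G_2(y(t))\left[\int_{h_2(t)}^t f_2(x(s))\,d_sR_2(t,s)-y(t)\right]$$ with the initial conditions $x(t)=\varphi(t)$, $y(t)=\psi(t)$ for $t\le 0$. The integrals are Stieltjes integrals in $s$ over $[h_i(t),t]$ including the endpoint atoms, i.e. with respect to the probability measure on $[h_i(t),t]$ with (left continuous) distribution function $R_i(t,\cdot)$. A solution is a pair $(x,y)$, locally absolutely continuous on $[0,\infty)$, which satisfies the system for almost all $t\ge0$ and the initial conditions for $t\le0$. Convention: $f_1^{-1}$ is the inverse of $f_1$ on its range, $f_1^{-1}(x)=0$ for $0\le x<f_1(0)$, and $f_1^{-1}(x)=+\infty$ for $x$ above the range of $f_1$. *)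

theory Defs
  imports "HOL-Analysis.Analysis"
begin

text \<open>Classical $\varepsilon$-$\delta$ absolute continuity (the library's \<open>absolutely_continuous\<close>
  concerns measures). A family of intervals is given by the set of its endpoint pairs.\<close>

definition abs_continuous_on_interval :: "real \<Rightarrow> real \<Rightarrow> (real \<Rightarrow> real) \<Rightarrow> bool" where
  "abs_continuous_on_interval a b f \<longleftrightarrow>
     (\<forall>\<epsilon>>0. \<exists>\<delta>>0. \<forall>D :: (real \<times> real) set.
        finite D \<and> (\<forall>(u, v)\<in>D. a \<le> u \<and> u < v \<and> v \<le> b) \<and>
        pairwise (\<lambda>p q. disjnt {fst p<..<snd p} {fst q<..<snd q}) D \<and>
        (\<Sum>(u, v)\<in>D. v - u) < \<delta> \<longrightarrow>
        (\<Sum>(u, v)\<in>D. \<bar>f v - f u\<bar>) < \<epsilon>)"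

definition locally_abs_continuous :: "(real \<Rightarrow> real) \<Rightarrow> bool" where
  "locally_abs_continuous f \<longleftrightarrow> (\<forall>T>0. abs_continuous_on_interval 0 T f)"

text \<open>For a left continuous non-decreasing \<open>R\<close>, the measure \<open>\<mu>\<close> with \<open>\<mu> [a, b) = R b - R a\<close>.
  Since \<open>interval_measure\<close> expects a right continuous function, it is applied to
  \<open>s \<mapsto> R(s\<^sup>+)\<close>, which determines the same measure.\<close>

definition stieltjes_measure :: "(real \<Rightarrow> real) \<Rightarrow> real measure" where
  "stieltjes_measure R = interval_measure (\<lambda>s. Lim (at_right s) R)"

definition stieltjes_integral :: "(real \<Rightarrow> real) \<Rightarrow> real \<Rightarrow> real \<Rightarrow> (real \<Rightarrow> real) \<Rightarrow> real" where
  "stieltjes_integral R a b g = (LINT s:{a..b}|stieltjes_measure R. g s)"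

text \<open>The inverse of an increasing function on \<open>[0, \<infinity>)\<close>, extended by \<open>0\<close> below its range and
  by \<open>\<infinity>\<close> above it. For continuous increasing \<open>f\<close> the range is an interval with least element
  \<open>f 0\<close>, so the last case is exactly that of a point above the range.\<close>

definition ext_inverse :: "(real \<Rightarrow> real) \<Rightarrow> real \<Rightarrow> ereal" where
  "ext_inverse f x =
     (if x < f 0 then 0
      else if x \<in> f ` {0..} then ereal (the_inv_into {0..} f x)
      else \<infinity>)"

text \<open>The functions \<open>f\<^sub>i\<close> and \<open>G\<^sub>i\<close> live on \<open>[0, \<infinity>)\<close> only, so a solution has to take
  its values there.\<close>

definition PG_solution ::
  "(real \<Rightarrow> real) \<Rightarrow> (real \<Rightarrow> real) \<Rightarrow> (real \<Rightarrow> real) \<Rightarrow> (real \<Rightarrow> real) \<Rightarrow>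
   (real \<Rightarrow> real) \<Rightarrow> (real \<Rightarrow> real) \<Rightarrow> (real \<Rightarrow> real) \<Rightarrow> (real \<Rightarrow> real) \<Rightarrow>
   (real \<Rightarrow> real \<Rightarrow> real) \<Rightarrow> (real \<Rightarrow> real \<Rightarrow> real) \<Rightarrow> (real \<Rightarrow> real) \<Rightarrow> (real \<Rightarrow> real) \<Rightarrow>
   (real \<Rightarrow> real) \<Rightarrow> (real \<Rightarrow> real) \<Rightarrow> bool" where
  "PG_solution r1 r2 G1 G2 f1 f2 h1 h2 R1 R2 \<phi> \<psi> x y \<longleftrightarrow>
     locally_abs_continuous x \<and> locally_abs_continuous y \<and>
     (\<forall>t\<ge>0. 0 \<le> x t \<and> 0 \<le> y t) \<and>
     (AE t in lebesgue_on {0..}.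
        (x has_real_derivative
           r1 t * G1 (x t) * (stieltjes_integral (R1 t) (h1 t) t (\<lambda>s. f1 (y s)) - x t)) (at t) \<and>
        (y has_real_derivative
           r2 t * G2 (y t) * (stieltjes_integral (R2 t) (h2 t) t (\<lambda>s. f2 (x s)) - y t)) (at t)) \<and>
     (\<forall>t\<le>0. x t = \<phi> t \<and> y t = \<psi> t)"

definition feedback_function :: "(real \<Rightarrow> real) \<Rightarrow> bool" where
  "feedback_function f \<longleftrightarrow>
     f ` {0..} \<subseteq> {0..} \<and> continuous_on {0..} f \<and> strict_mono_on {0..} f \<and> (\<forall>x>0. f x > 0)"

definition gain_function :: "(real \<Rightarrow> real) \<Rightarrow> bool" where
  "gain_function G \<longleftrightarrow>
     G ` {0..} \<subseteq> {0..} \<and> continuous_on {0..} G \<and> (\<forall>x>0. G x > 0)"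

definition delay_function :: "(real \<Rightarrow> real) \<Rightarrow> bool" where
  "delay_function h \<longleftrightarrow>
     h \<in> borel_measurable (lebesgue_on {0..}) \<and> (\<forall>t\<ge>0. h t \<le> t) \<and> filterlim h at_top at_top"

text \<open>Only times \<open>t \<ge> 0\<close> matter. Beyond \<open>s = t\<close>, \<open>R t\<close> may exceed \<open>1\<close>; the integrals are
  over \<open>[h t, t]\<close>, to which \<open>stieltjes_measure (R t)\<close> gives mass \<open>1\<close>.\<close>

definition delay_distribution :: "(real \<Rightarrow> real) \<Rightarrow> (real \<Rightarrow> real \<Rightarrow> real) \<Rightarrow> bool" where
  "delay_distribution h R \<longleftrightarrow>
     (\<forall>t\<ge>0. mono (R t) \<and> (\<forall>s. continuous (at_left s) (R t)) \<and>
            (\<forall>s\<le>h t. R t s = 0) \<and> (R t \<longlongrightarrow> 1) (at_right t)) \<and>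
     (\<forall>s. \<forall>T>0. (\<lambda>t. R t s) absolutely_integrable_on {0..T})"

definition rate_function :: "(real \<Rightarrow> real) \<Rightarrow> bool" where
  "rate_function r \<longleftrightarrow>
     r \<in> borel_measurable (lebesgue_on {0..}) \<and>
     (\<exists>C. AE t in lebesgue_on {0..}. \<bar>r t\<bar> \<le> C) \<and>
     (\<forall>t\<ge>0. r t \<ge> 0) \<and>
     (\<integral>\<^sup>+t. ennreal (r t) \<partial>lebesgue_on {0..}) = \<infinity>"

definition initial_function :: "(real \<Rightarrow> real) \<Rightarrow> bool" where
  "initial_function \<phi> \<longleftrightarrow>
     continuous_on {..0} \<phi> \<and> bounded (\<phi> ` {..0}) \<and> (\<forall>t<0. \<phi> t \<ge> 0) \<and> \<phi> 0 > 0"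

end

(*
  The hypothesis of 1) says f1 (f2 z) < z and f2 (f1 z) < z for all z > 0, that of 2) the same with
  the inequalities reversed. Bounds on one component carry over to the other: if eventually y <= b,
  then the integral in the equation of x is eventually at most f1 b, and as r1 has infinite integral,
  x drops below any c > f1 b and stays there, provided that x is bounded (so that G1 is bounded away
  from 0 where x >= c). Hence, if a > 0 is an eventual upper bound of x, so is every number
  above f1 (f2 a), and the infimum of these bounds can only be 0. Boundedness comes from the invariant rectangle
  [0, a] x [0, b] with a = max a0 (f1 b0) and b = max b0 (f2 a0). Part 2) is the mirror image with
  min instead of max, started after the delays have left the region t < 0, where the initial
  functions may vanish.
*)
theory Submission
  imports Defs
begin

section \<open>Absolutely continuous functions\<close>

text \<open>The equations hold only almost everywhere, and the Stieltjes terms are controlled only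
  by pointwise bounds. Everything is therefore drawn from one integrated inequality: the increment
  of an absolutely continuous function is at most the integral of a majorant of its derivative. The
  gauge integral yields the integrability of the derivative along with its value, and the majorants
  used are only constants and multiples of a rate \<open>r\<close>. Two differential inequalities
  for the distance z of a component to a level do the work. With \<open>r * G\<close> merely bounded
  on a finite interval, z' >= -K z keeps a positive distance positive; this gives the invariant
  rectangles and, at level 0, the positivity of solutions. With \<open>G\<close> bounded away from
  0, z' <= -k r forces z to become nonpositive, as the integral of \<open>r\<close> diverges. Since
  \<open>G\<close> may vanish at 0 and may tend to 0 at infinity, the second inequality is available
  only once the component is confined: from above for part 1), away from 0 for part 2).\<close>

text \<open>Absolute continuity speaks of sets of endpoint pairs \<open>u < v\<close>, while a
  tagged partition may contain degenerate intervals. These contribute nothing to the sum, and on the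
  rest the passage to endpoints is injective, because distinct members have disjoint
  interiors.\<close>

lemma abs_continuous_onD_tagged:
  fixes f :: "real \<Rightarrow> real"
  assumes \<delta>: "\<forall>D :: (real \<times> real) set.
        finite D \<and> (\<forall>(u, v)\<in>D. a \<le> u \<and> u < v \<and> v \<le> b) \<and>
        pairwise (\<lambda>p q. disjnt {fst p<..<snd p} {fst q<..<snd q}) D \<and>
        (\<Sum>(u, v)\<in>D. v - u) < \<delta> \<longrightarrow> (\<Sum>(u, v)\<in>D. \<bar>f v - f u\<bar>) < \<epsilon>"
    and p: "p tagged_partial_division_of {a..b}"
    and small: "(\<Sum>(x, K)\<in>p. measure lborel K) < \<delta>"
  shows "(\<Sum>(x, K)\<in>p. \<bar>f (Sup K) - f (Inf K)\<bar>) < \<epsilon>"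
proof -
  define q where "q = {(x, K)\<in>p. Inf K < Sup K}"
  define e where "e = (\<lambda>(x :: real, K :: real set). (Inf K, Sup K))"
  have fin: "finite p" and finq: "finite q" and qp: "q \<subseteq> p"
    using p unfolding q_def tagged_partial_division_of_def by (auto intro: finite_subset)
  have interval: "K = {Inf K..Sup K} \<and> Inf K \<le> Sup K \<and> a \<le> Inf K \<and> Sup K \<le> b \<and> x \<in> K"
    if xK: "(x, K) \<in> p" for x K
  proof -
    obtain u v where "K = {u..v}" "x \<in> K" "K \<subseteq> {a..b}"
      using p xK unfolding tagged_partial_division_of_def by (metis box_real(2))
    then show ?thesis by (auto)
  qed
  have content: "measure lborel K = Sup K - Inf K" if "(x, K) \<in> p" for x K
    using interval[OF that] by (metis content_real)
  have disj: "{Inf K<..<Sup K} \<inter> {Inf L<..<Sup L} = {}"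
    if "(x, K) \<in> p" "(y, L) \<in> p" "(x, K) \<noteq> (y, L)" for x K y L
  proof -
    have "interior K \<inter> interior L = {}"
      using p that unfolding tagged_partial_division_of_def by blast
    then show ?thesis
      using interval[OF that(1)] interval[OF that(2)] by (metis interior_atLeastAtMost_real)
  qed
  have inj: "inj_on e q"
  proof (rule inj_onI, clarsimp simp: e_def q_def)
    fix x K y L
    assume A: "(x, K) \<in> p" "(y, L) \<in> p" "Inf K = Inf L" "Sup K = Sup L" "Inf L < Sup L"
    show "x = y \<and> K = L"
      using disj[OF A(1,2)] A by auto
  qed
  have "(\<Sum>(x, K)\<in>p. \<bar>f (Sup K) - f (Inf K)\<bar>) = (\<Sum>(x, K)\<in>q. \<bar>f (Sup K) - f (Inf K)\<bar>)"
    using fin interval by (intro sum.mono_neutral_right) (force simp: q_def)+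
  also have "\<dots> = (\<Sum>(u, v)\<in>e ` q. \<bar>f v - f u\<bar>)"
    by (subst sum.reindex[OF inj]) (simp add: e_def case_prod_unfold)
  also have "\<dots> < \<epsilon>"
  proof (rule \<delta>[rule_format], intro conjI)
    show "finite (e ` q)" using finq by simp
    show "\<forall>(u, v)\<in>e ` q. a \<le> u \<and> u < v \<and> v \<le> b"
      using interval by (auto simp: e_def q_def)
    show "pairwise (\<lambda>p q. disjnt {fst p<..<snd p} {fst q<..<snd q}) (e ` q)"
      using disj by (fastforce simp: pairwise_def disjnt_def e_def q_def)
    have "(\<Sum>(u, v)\<in>e ` q. v - u) = (\<Sum>(x, K)\<in>q. Sup K - Inf K)"
      by (subst sum.reindex[OF inj]) (simp add: e_def case_prod_unfold)
    also have "\<dots> = (\<Sum>(x, K)\<in>q. measure lborel K)"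
      using qp content by (intro sum.cong) auto
    also have "\<dots> \<le> (\<Sum>(x, K)\<in>p. measure lborel K)"
      using fin qp by (intro sum_mono2) auto
    finally show "(\<Sum>(u, v)\<in>e ` q. v - u) < \<delta>" using small by simp
  qed
  finally show ?thesis .
qed

text \<open>The gauge combines the derivative estimate off \<open>N\<close> with a gauge witnessing that the
  indicator of \<open>N\<close> has integral 0; the latter makes the intervals tagged in \<open>N\<close> short enough
  in total for absolute continuity to apply.\<close>

theorem fundamental_theorem_of_calculus_abs_continuous:
  fixes f :: "real \<Rightarrow> real"
  assumes "a \<le> b" and ac: "abs_continuous_on_interval a b f" and N: "negligible N"
    and deriv: "\<And>t. t \<in> {a..b} - N \<Longrightarrow> (f has_real_derivative f' t) (at t within {a..b})"
  shows "(f' has_integral (f b - f a)) {a..b}"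
proof -
  \<comment> \<open>Nothing is known about \<open>f'\<close> on \<open>N\<close>. With the value 0
    there, the terms of a Riemann sum tagged in \<open>N\<close> reduce to increments of
    \<open>f\<close>.\<close>
  define g where "g = (\<lambda>t. if t \<in> N then 0 else f' t)"
  have "(g has_integral (f b - f a)) {a..b}"
    unfolding has_integral_real
  proof (intro allI impI)
    fix e :: real assume "e > 0"
    \<comment> \<open>Half of \<open>e\<close> is reserved for the tags off \<open>N\<close>, whose
      errors add up to at most \<open>\<epsilon> * (b - a)\<close>; the summand 1 covers
      \<open>a = b\<close>.\<close>
    define \<epsilon> where "\<epsilon> = e / (2 * (b - a + 1))"
    have "\<epsilon> > 0" using \<open>e > 0\<close> \<open>a \<le> b\<close> by (simp add: \<epsilon>_def)
    have "\<exists>\<delta>>0. \<forall>D :: (real \<times> real) set.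
        finite D \<and> (\<forall>(u, v)\<in>D. a \<le> u \<and> u < v \<and> v \<le> b) \<and>
        pairwise (\<lambda>p q. disjnt {fst p<..<snd p} {fst q<..<snd q}) D \<and>
        (\<Sum>(u, v)\<in>D. v - u) < \<delta> \<longrightarrow> (\<Sum>(u, v)\<in>D. \<bar>f v - f u\<bar>) < e / 2"
      by (rule ac[unfolded abs_continuous_on_interval_def, rule_format]) (simp add: \<open>e > 0\<close>)
    then obtain \<delta> where "\<delta> > 0" and
      \<delta>: "\<forall>D :: (real \<times> real) set.
        finite D \<and> (\<forall>(u, v)\<in>D. a \<le> u \<and> u < v \<and> v \<le> b) \<and>
        pairwise (\<lambda>p q. disjnt {fst p<..<snd p} {fst q<..<snd q}) D \<and>
        (\<Sum>(u, v)\<in>D. v - u) < \<delta> \<longrightarrow> (\<Sum>(u, v)\<in>D. \<bar>f v - f u\<bar>) < e / 2"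
      by blast
    have N0: "(indicat_real N has_integral 0) {a..b}"
      using N unfolding negligible by blast
    have "\<exists>\<gamma>. gauge \<gamma> \<and> (\<forall>p. p tagged_division_of {a..b} \<and> \<gamma> fine p \<longrightarrow>
        norm ((\<Sum>(x, K)\<in>p. measure lborel K *\<^sub>R indicat_real N x) - 0) < \<delta>)"
      by (rule N0[unfolded has_integral_real, rule_format, OF \<open>\<delta> > 0\<close>])
    then obtain \<gamma> where "gauge \<gamma>" and \<gamma>: "\<forall>p. p tagged_division_of {a..b} \<and> \<gamma> fine p \<longrightarrow>
        norm ((\<Sum>(x, K)\<in>p. measure lborel K *\<^sub>R indicat_real N x) - 0) < \<delta>"
      by blast
    have "\<forall>x. \<exists>d>0. x \<in> {a..b} - N \<longrightarrow>
         (\<forall>y\<in>{a..b}. \<bar>y - x\<bar> < d \<longrightarrow> \<bar>f y - f x - f' x * (y - x)\<bar> \<le> \<epsilon> * \<bar>y - x\<bar>)"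
    proof
      fix x
      show "\<exists>d>0. x \<in> {a..b} - N \<longrightarrow>
         (\<forall>y\<in>{a..b}. \<bar>y - x\<bar> < d \<longrightarrow> \<bar>f y - f x - f' x * (y - x)\<bar> \<le> \<epsilon> * \<bar>y - x\<bar>)"
      proof (cases "x \<in> {a..b} - N")
        case True
        then have "(f has_derivative (*) (f' x)) (at x within {a..b})"
          using deriv by (simp add: has_field_derivative_def)
        then show ?thesis
          using \<open>\<epsilon> > 0\<close> unfolding has_derivative_within_alt by simp blast
      qed (auto intro: exI[of _ 1])
    qed
    from choice[OF this] obtain d where dd: "\<forall>x. d x > 0 \<and> (x \<in> {a..b} - N \<longrightarrow>
         (\<forall>y\<in>{a..b}. \<bar>y - x\<bar> < d x \<longrightarrow> \<bar>f y - f x - f' x * (y - x)\<bar> \<le> \<epsilon> * \<bar>y - x\<bar>))"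
      by blast
    then have d0: "\<And>x. d x > 0" and
      d: "\<And>x y. x \<in> {a..b} - N \<Longrightarrow> y \<in> {a..b} \<Longrightarrow> \<bar>y - x\<bar> < d x \<Longrightarrow>
         \<bar>f y - f x - f' x * (y - x)\<bar> \<le> \<epsilon> * \<bar>y - x\<bar>"
      by blast+
    define \<Gamma> where "\<Gamma> = (\<lambda>x. ball x (d x) \<inter> \<gamma> x)"
    show "\<exists>\<Gamma>. gauge \<Gamma> \<and> (\<forall>p. p tagged_division_of {a..b} \<and> \<Gamma> fine p \<longrightarrow>
        norm ((\<Sum>(x, K)\<in>p. measure lborel K *\<^sub>R g x) - (f b - f a)) < e)"
    proof (intro exI[of _ \<Gamma>] conjI allI impI)
      show "gauge \<Gamma>"
        unfolding \<Gamma>_def using d0 \<open>gauge \<gamma>\<close> by (intro gauge_Int gauge_ball_dependent) auto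
      fix p assume p: "p tagged_division_of {a..b} \<and> \<Gamma> fine p"
      then have fineb: "(\<lambda>x. ball x (d x)) fine p" and fine\<gamma>: "\<gamma> fine p"
        unfolding \<Gamma>_def fine_Int by auto
      have fin: "finite p" using p by auto
      define p1 where "p1 = {(x, K)\<in>p. x \<notin> N}"
      define p2 where "p2 = {(x, K)\<in>p. x \<in> N}"
      have split: "p = p1 \<union> p2" "p1 \<inter> p2 = {}" "finite p1" "finite p2" "p2 \<subseteq> p"
        using fin by (auto simp: p1_def p2_def intro: finite_subset[OF _ fin])
      have sums: "b - a = (\<Sum>(x,K)\<in>p. Sup K - Inf K)" "f b - f a = (\<Sum>(x,K)\<in>p. f (Sup K) - f (Inf K))"
        using additive_tagged_division_1[OF \<open>a \<le> b\<close>, where f = "\<lambda>x. x"]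
          additive_tagged_division_1[OF \<open>a \<le> b\<close>, where f = f] p by auto
      have interval: "\<exists>u v. K = {u..v} \<and> x \<in> K \<and> K \<subseteq> {a..b}" if "(x, K) \<in> p" for x K
        using p that unfolding tagged_division_of_def tagged_partial_division_of_def
        by (metis box_real(2))
      have good: "\<bar>measure lborel K * g x - (f (Sup K) - f (Inf K))\<bar> \<le> \<epsilon> * (Sup K - Inf K)"
        if "(x, K) \<in> p1" for x K
      proof -
        have xK: "(x, K) \<in> p" "x \<notin> N" using that by (auto simp: p1_def)
        obtain u v where K: "K = {u..v}" "x \<in> K" "K \<subseteq> {a..b}"
          using interval[OF xK(1)] by blast
        then have uxv: "u \<le> x" "x \<le> v" by auto
        have near: "y \<in> ball x (d x)" if "y \<in> K" for y
          using fineb xK that unfolding fine_def by blast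
        \<comment> \<open>The tag lies between the endpoints, so the two one-sided errors are
          proportional to \<open>x - u\<close> and \<open>v - x\<close>, which add up to the length
          of the interval.\<close>
        have "\<bar>f u - f x - f' x * (u - x)\<bar> \<le> \<epsilon> * (x - u)"
          using d[of x u] near[of u] K xK uxv by (auto simp: dist_real_def)
        moreover have "\<bar>f v - f x - f' x * (v - x)\<bar> \<le> \<epsilon> * (v - x)"
          using d[of x v] near[of v] K xK uxv by (auto simp: dist_real_def)
        ultimately have "\<bar>(v - u) * f' x - (f v - f u)\<bar> \<le> \<epsilon> * (x - u) + \<epsilon> * (v - x)"
          by (simp add: algebra_simps)
        then show ?thesis using K uxv xK by (simp add: g_def algebra_simps)
      qed
      have Sup_ge: "Inf K \<le> Sup K" if "(x, K) \<in> p" for x K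
        using interval[OF that] by auto
      have "(\<Sum>(x, K)\<in>p2. \<bar>f (Sup K) - f (Inf K)\<bar>) < e / 2"
      proof (rule abs_continuous_onD_tagged[OF \<delta>])
        show "p2 tagged_partial_division_of {a..b}"
          using p split(5) unfolding tagged_division_of_def
          by (meson tagged_partial_division_subset)
        \<comment> \<open>The Riemann sum of the indicator of \<open>N\<close> is the total length
          of the intervals tagged in \<open>N\<close>.\<close>
        have "(\<Sum>(x, K)\<in>p. measure lborel K *\<^sub>R indicat_real N x) = (\<Sum>(x, K)\<in>p2. measure lborel K)"
          using fin by (intro sum.mono_neutral_cong_right) (auto simp: p2_def indicator_def)
        then show "(\<Sum>(x, K)\<in>p2. measure lborel K) < \<delta>"
          using \<gamma>[rule_format, of p] p fine\<gamma> by auto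
      qed
      moreover have "\<bar>\<Sum>(x, K)\<in>p2. measure lborel K * g x - (f (Sup K) - f (Inf K))\<bar>
          \<le> (\<Sum>(x, K)\<in>p2. \<bar>f (Sup K) - f (Inf K)\<bar>)"
        by (rule order_trans[OF sum_abs], rule sum_mono) (auto simp: p2_def g_def)
      moreover have "\<bar>\<Sum>(x, K)\<in>p1. measure lborel K * g x - (f (Sup K) - f (Inf K))\<bar> \<le> e / 2"
      proof -
        have "\<bar>\<Sum>(x, K)\<in>p1. measure lborel K * g x - (f (Sup K) - f (Inf K))\<bar>
            \<le> (\<Sum>(x, K)\<in>p1. \<epsilon> * (Sup K - Inf K))"
          by (rule order_trans[OF sum_abs], rule sum_mono) (auto simp: good)
        also have "\<dots> \<le> (\<Sum>(x, K)\<in>p. \<epsilon> * (Sup K - Inf K))"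
          using fin \<open>\<epsilon> > 0\<close> by (intro sum_mono2) (auto simp: p1_def Sup_ge)
        also have "\<dots> = \<epsilon> * (b - a)"
          unfolding sums(1) by (simp add: sum_distrib_left case_prod_unfold)
        also have "\<dots> \<le> e / 2"
          using \<open>e > 0\<close> \<open>a \<le> b\<close> by (simp add: \<epsilon>_def field_simps)
        finally show ?thesis .
      qed
      moreover have "(\<Sum>(x, K)\<in>p. measure lborel K *\<^sub>R g x) - (f b - f a)
          = (\<Sum>(x, K)\<in>p1. measure lborel K * g x - (f (Sup K) - f (Inf K)))
          + (\<Sum>(x, K)\<in>p2. measure lborel K * g x - (f (Sup K) - f (Inf K)))"
        unfolding sums(2) using split(2-4)
        by (simp add: split(1) case_prod_unfold sum.union_disjoint sum_subtractf)
      ultimately show "norm ((\<Sum>(x, K)\<in>p. measure lborel K *\<^sub>R g x) - (f b - f a)) < e"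
        by (simp only: real_norm_def)
    qed
  qed
  then show ?thesis
    by (rule has_integral_spike[OF N, rotated]) (auto simp: g_def)
qed

section \<open>Elementary properties of absolute continuity and the integrated inequality\<close>

lemma abs_continuous_subinterval:
  assumes "abs_continuous_on_interval a b f" "a \<le> c" "d \<le> b"
  shows "abs_continuous_on_interval c d f"
  unfolding abs_continuous_on_interval_def
proof (intro allI impI)
  fix e :: real assume "e > 0"
  from assms(1)[unfolded abs_continuous_on_interval_def, rule_format, OF this]
  obtain \<delta> where "\<delta> > 0" and \<delta>: "\<And>D :: (real \<times> real) set.
        finite D \<and> (\<forall>(u, v)\<in>D. a \<le> u \<and> u < v \<and> v \<le> b) \<and>
        pairwise (\<lambda>p q. disjnt {fst p<..<snd p} {fst q<..<snd q}) D \<and>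
        (\<Sum>(u, v)\<in>D. v - u) < \<delta> \<Longrightarrow> (\<Sum>(u, v)\<in>D. \<bar>f v - f u\<bar>) < e"
    by blast
  show "\<exists>\<delta>>0. \<forall>D :: (real \<times> real) set.
        finite D \<and> (\<forall>(u, v)\<in>D. c \<le> u \<and> u < v \<and> v \<le> d) \<and>
        pairwise (\<lambda>p q. disjnt {fst p<..<snd p} {fst q<..<snd q}) D \<and>
        (\<Sum>(u, v)\<in>D. v - u) < \<delta> \<longrightarrow> (\<Sum>(u, v)\<in>D. \<bar>f v - f u\<bar>) < e"
  proof (intro exI[of _ \<delta>] conjI allI impI)
    fix D :: "(real \<times> real) set"
    assume D: "finite D \<and> (\<forall>(u, v)\<in>D. c \<le> u \<and> u < v \<and> v \<le> d) \<and>
        pairwise (\<lambda>p q. disjnt {fst p<..<snd p} {fst q<..<snd q}) D \<and>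
        (\<Sum>(u, v)\<in>D. v - u) < \<delta>"
    then have "\<forall>(u, v)\<in>D. a \<le> u \<and> u < v \<and> v \<le> b"
      using assms(2,3) by fastforce
    with D show "(\<Sum>(u, v)\<in>D. \<bar>f v - f u\<bar>) < e" by (intro \<delta>) simp
  qed (rule \<open>\<delta> > 0\<close>)
qed

text \<open>With \<open>k = 1\<close> or \<open>k = -1\<close> this covers the distance of a
  component to a level from either side, which is why such distances are later written
  \<open>a + - 1 * x t\<close> and \<open>- a + 1 * x t\<close>.\<close>

lemma abs_continuous_affine:
  assumes "abs_continuous_on_interval a b f"
  shows "abs_continuous_on_interval a b (\<lambda>t. c + k * f t)"
  unfolding abs_continuous_on_interval_def
proof (intro allI impI)
  fix e :: real assume "e > 0"
  \<comment> \<open>The added 1 allows for \<open>k = 0\<close>.\<close>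
  then have "e / (\<bar>k\<bar> + 1) > 0" by simp
  from assms[unfolded abs_continuous_on_interval_def, rule_format, OF this]
  obtain \<delta> where "\<delta> > 0" and \<delta>: "\<And>D :: (real \<times> real) set.
        finite D \<and> (\<forall>(u, v)\<in>D. a \<le> u \<and> u < v \<and> v \<le> b) \<and>
        pairwise (\<lambda>p q. disjnt {fst p<..<snd p} {fst q<..<snd q}) D \<and>
        (\<Sum>(u, v)\<in>D. v - u) < \<delta> \<Longrightarrow> (\<Sum>(u, v)\<in>D. \<bar>f v - f u\<bar>) < e / (\<bar>k\<bar> + 1)"
    by blast
  show "\<exists>\<delta>>0. \<forall>D :: (real \<times> real) set.
        finite D \<and> (\<forall>(u, v)\<in>D. a \<le> u \<and> u < v \<and> v \<le> b) \<and>
        pairwise (\<lambda>p q. disjnt {fst p<..<snd p} {fst q<..<snd q}) D \<and>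
        (\<Sum>(u, v)\<in>D. v - u) < \<delta> \<longrightarrow>
        (\<Sum>(u, v)\<in>D. \<bar>(c + k * f v) - (c + k * f u)\<bar>) < e"
  proof (intro exI[of _ \<delta>] conjI allI impI)
    fix D :: "(real \<times> real) set"
    assume D: "finite D \<and> (\<forall>(u, v)\<in>D. a \<le> u \<and> u < v \<and> v \<le> b) \<and>
        pairwise (\<lambda>p q. disjnt {fst p<..<snd p} {fst q<..<snd q}) D \<and>
        (\<Sum>(u, v)\<in>D. v - u) < \<delta>"
    let ?S = "\<Sum>(u, v)\<in>D. \<bar>f v - f u\<bar>"
    have "(\<Sum>(u, v)\<in>D. \<bar>(c + k * f v) - (c + k * f u)\<bar>) = \<bar>k\<bar> * ?S"
      by (auto simp: sum_distrib_left simp flip: right_diff_distrib abs_mult intro!: sum.cong)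
    also have "\<dots> \<le> (\<bar>k\<bar> + 1) * ?S"
      by (intro mult_right_mono sum_nonneg) auto
    also have "\<dots> < e"
      using \<delta>[OF D] by (simp add: field_simps)
    finally show "(\<Sum>(u, v)\<in>D. \<bar>(c + k * f v) - (c + k * f u)\<bar>) < e" .
  qed (rule \<open>\<delta> > 0\<close>)
qed

lemma abs_continuous_imp_continuous_on:
  assumes "abs_continuous_on_interval a b f"
  shows "continuous_on {a..b} f"
  unfolding continuous_on_iff
proof (intro ballI allI impI)
  fix x e :: real assume x: "x \<in> {a..b}" and "e > 0"
  from assms[unfolded abs_continuous_on_interval_def, rule_format, OF \<open>e > 0\<close>]
  obtain \<delta> where "\<delta> > 0" and \<delta>: "\<And>D :: (real \<times> real) set.
        finite D \<and> (\<forall>(u, v)\<in>D. a \<le> u \<and> u < v \<and> v \<le> b) \<and>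
        pairwise (\<lambda>p q. disjnt {fst p<..<snd p} {fst q<..<snd q}) D \<and>
        (\<Sum>(u, v)\<in>D. v - u) < \<delta> \<Longrightarrow> (\<Sum>(u, v)\<in>D. \<bar>f v - f u\<bar>) < e"
    by blast
  have less: "\<bar>f v - f u\<bar> < e" if "a \<le> u" "u < v" "v \<le> b" "v - u < \<delta>" for u v
    using \<delta>[of "{(u, v)}"] that by simp
  show "\<exists>d>0. \<forall>x'\<in>{a..b}. dist x' x < d \<longrightarrow> dist (f x') (f x) < e"
  proof (intro exI[of _ \<delta>] conjI ballI impI)
    fix y assume "y \<in> {a..b}" "dist y x < \<delta>"
    then show "dist (f y) (f x) < e"
      using less[of x y] less[of y x] x \<open>e > 0\<close>
      by (cases y x rule: linorder_cases) (auto simp: dist_real_def)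
  qed (rule \<open>\<delta> > 0\<close>)
qed

lemma AE_lebesgue_negligibleE:
  assumes "AE t in lebesgue. P t"
  obtains N where "negligible N" "\<And>t. t \<notin> N \<Longrightarrow> P t"
proof -
  from assms obtain N where "N \<in> null_sets lebesgue" "{t \<in> space lebesgue. \<not> P t} \<subseteq> N"
    unfolding eventually_ae_filter by blast
  then show thesis
    by (intro that[of N]) (auto simp: negligible_iff_null_sets)
qed

text \<open>Integrability is asked of the majorant alone; that of the derivative is part of the
  conclusion of the fundamental theorem.\<close>

lemma abs_continuous_diff_le:
  fixes z g :: "real \<Rightarrow> real"
  assumes "a \<le> b" and ac: "abs_continuous_on_interval a b z"
    and g: "g integrable_on {a..b}"
    and deriv: "AE t in lebesgue. a < t \<and> t < b \<longrightarrow> (\<exists>D. (z has_real_derivative D) (at t) \<and> D \<le> g t)"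
  shows "z b - z a \<le> integral {a..b} g"
proof -
  obtain N0 where N0: "negligible N0" and deriv': "\<And>t. t \<notin> N0 \<Longrightarrow> a < t \<and> t < b \<longrightarrow>
      (\<exists>D. (z has_real_derivative D) (at t) \<and> D \<le> g t)"
    by (rule AE_lebesgue_negligibleE[OF deriv]) (rule that)
  \<comment> \<open>The hypothesis covers the open interval only, so the endpoints join the
    exceptional set.\<close>
  define N where "N = N0 \<union> {a, b}"
  have N: "negligible N"
    using N0 by (auto simp: N_def intro!: negligible_Un)
  have good: "(z has_real_derivative deriv z t) (at t) \<and> deriv z t \<le> g t" if "t \<in> {a..b} - N" for t
    using that deriv'[of t] by (auto simp: N_def dest: DERIV_imp_deriv)
  have "(deriv z has_integral (z b - z a)) {a..b}"
    by (rule fundamental_theorem_of_calculus_abs_continuous[OF \<open>a \<le> b\<close> ac N])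
      (use good in \<open>blast intro: DERIV_subset\<close>)
  \<comment> \<open>On \<open>N\<close> the majorant is replaced by the derivative itself, so that
    the comparison holds at every point.\<close>
  moreover have "((\<lambda>t. if t \<in> N then deriv z t else g t) has_integral integral {a..b} g) {a..b}"
    by (rule has_integral_spike[OF N _ integrable_integral[OF g]]) auto
  ultimately show ?thesis
    by (rule has_integral_le) (use good in auto)
qed

section \<open>Differential inequalities\<close>

text \<open>Integrating from the maximum \<open>s\<close> of \<open>z\<close> on a final interval of length at most
  \<open>1 / (2 (K + 1))\<close> loses at most half of \<open>z s\<close>, so no integrating factor is needed.\<close>

lemma stay_positive:
  fixes z :: "real \<Rightarrow> real"
  assumes "p < q" and ac: "abs_continuous_on_interval p q z"
    and pos: "\<And>t. p \<le> t \<Longrightarrow> t < q \<Longrightarrow> z t > 0" and "K \<ge> 0"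
    and deriv: "AE t in lebesgue. p < t \<and> t < q \<longrightarrow>
      (\<exists>D. (z has_real_derivative D) (at t) \<and> - K * z t \<le> D)"
  shows "z q > 0"
proof -
  define p' where "p' = max p (q - 1 / (2 * (K + 1)))"
  have p': "p \<le> p'" "p' < q" "q - p' \<le> 1 / (2 * (K + 1))"
    using \<open>p < q\<close> \<open>K \<ge> 0\<close> by (auto simp: p'_def)
  have "continuous_on {p'..q} z"
    using abs_continuous_imp_continuous_on[OF ac] p' continuous_on_subset by fastforce
  then obtain s where s: "s \<in> {p'..q}" and max: "\<And>t. t \<in> {p'..q} \<Longrightarrow> z t \<le> z s"
    using p' continuous_attains_sup[of "{p'..q}" z] by auto
  have "z s > 0"
    using max[of p'] pos[of p'] p' by auto
  have "(- z q) - (- z s) \<le> integral {s..q} (\<lambda>_. K * z s)"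
  proof (rule abs_continuous_diff_le)
    show "abs_continuous_on_interval s q (\<lambda>t. - z t)"
      using abs_continuous_affine[OF abs_continuous_subinterval[OF ac, of s q], of 0 "-1"] s p' by simp
    show "AE t in lebesgue. s < t \<and> t < q \<longrightarrow>
        (\<exists>D. ((\<lambda>t. - z t) has_real_derivative D) (at t) \<and> D \<le> K * z s)"
      using deriv
    proof eventually_elim
      case (elim t)
      show ?case
      proof
        assume t: "s < t \<and> t < q"
        then obtain D where D: "(z has_real_derivative D) (at t)" "- K * z t \<le> D"
          using elim s p' by auto
        moreover have "K * z t \<le> K * z s"
          using max[of t] t s \<open>K \<ge> 0\<close> by (intro mult_left_mono) auto
        ultimately show "\<exists>D. ((\<lambda>t. - z t) has_real_derivative D) (at t) \<and> D \<le> K * z s"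
          by (intro exI[of _ "- D"]) (auto intro: DERIV_minus)
      qed
    qed
  qed (use s in auto)
  also have "\<dots> = (K * (q - s)) * z s"
    using s by simp
  also have "\<dots> \<le> 1 / 2 * z s"
  proof (rule mult_right_mono)
    have "K * (q - s) \<le> K * (1 / (2 * (K + 1)))"
      using s p' \<open>K \<ge> 0\<close> by (intro mult_left_mono) auto
    also have "\<dots> \<le> 1 / 2"
      using \<open>K \<ge> 0\<close> by (simp add: field_simps)
    finally show "K * (q - s) \<le> 1 / 2" .
  qed (use \<open>z s > 0\<close> in simp)
  finally show ?thesis using \<open>z s > 0\<close> by simp
qed

text \<open>The set where \<open>w\<close> is not positive is closed, so it would contain its
  infimum, and \<open>step\<close> excludes that point. For the coupled system \<open>w\<close> is
  the minimum of two distances: each component needs the bound on the other, and up to the first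
  exit time both are available.\<close>

lemma continuous_induction_pos:
  fixes w :: "real \<Rightarrow> real"
  assumes cont: "continuous_on {T..} w" and "w T > 0"
    and step: "\<And>q. T < q \<Longrightarrow> (\<And>t. T \<le> t \<Longrightarrow> t < q \<Longrightarrow> w t > 0) \<Longrightarrow> w q > 0"
    and "t \<ge> T"
  shows "w t > 0"
proof (rule ccontr)
  assume "\<not> w t > 0"
  define S where "S = {T..} \<inter> w -` {..0}"
  have "closed S"
    unfolding S_def by (intro continuous_closed_preimage cont) auto
  moreover have "S \<noteq> {}" "bdd_below S"
    using \<open>\<not> w t > 0\<close> \<open>t \<ge> T\<close> by (auto simp: S_def)
  ultimately have "Inf S \<in> S"
    by (rule closed_contains_Inf[rotated 2])
  then have "Inf S \<ge> T" "w (Inf S) \<le> 0" by (auto simp: S_def)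
  moreover have "w s > 0" if "T \<le> s" "s < Inf S" for s
    using that cInf_lower[OF _ \<open>bdd_below S\<close>, of s] by (force simp: S_def)
  ultimately show False
    using step[of "Inf S"] \<open>w T > 0\<close> by (cases "Inf S = T") auto
qed

section \<open>Rates: local integrability, divergence of the integral, and its effect\<close>

lemma rate_function_integrable:
  assumes "rate_function r" "0 \<le> a"
  shows "r integrable_on {a..b}"
proof -
  obtain C where C: "AE t in lebesgue. t \<in> {0..} \<longrightarrow> \<bar>r t\<bar> \<le> C"
    using assms by (auto simp: rate_function_def AE_restrict_space_iff)
  obtain N where N: "negligible N" "\<And>t. t \<notin> N \<Longrightarrow> t \<in> {0..} \<longrightarrow> \<bar>r t\<bar> \<le> C"
    by (rule AE_lebesgue_negligibleE[OF C]) (rule that)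
  have r0: "r \<in> borel_measurable (lebesgue_on {0..})"
    using assms by (auto simp: rate_function_def)
  have "r \<in> borel_measurable (lebesgue_on {a..b})"
    by (rule measurable_restrict_mono[OF r0]) (use assms in auto)
  \<comment> \<open>The bound \<open>C\<close> may fail on \<open>N\<close>, where the dominating
    function is therefore \<open>\<bar>r t\<bar>\<close> itself.\<close>
  moreover have "(\<lambda>t. if t \<in> N then \<bar>r t\<bar> else C) integrable_on {a..b}"
    by (rule integrable_spike[OF integrable_const_ivl N(1)]) auto
  ultimately show ?thesis
    by (rule measurable_bounded_by_integrable_imp_integrable) (use N(2) assms in auto)
qed

text \<open>Divergence is assumed for the nonnegative Lebesgue integral, while the estimates use
  gauge integrals over compact intervals. Monotone convergence along \<open>{0..real n}\<close>
  connects them: a common bound for the latter would make the former finite.\<close>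

lemma rate_function_integral_unbounded:
  assumes r: "rate_function r" and "0 \<le> T"
  shows "\<exists>b\<ge>T. integral {T..b} r > B"
proof (rule ccontr)
  assume "\<not> ?thesis"
  then have le: "integral {T..b} r \<le> B" if "b \<ge> T" for b
    using that by force
  have nonneg: "\<And>t. t \<ge> 0 \<Longrightarrow> r t \<ge> 0" and meas: "r \<in> borel_measurable (lebesgue_on {0..})"
    and inf: "(\<integral>\<^sup>+t. ennreal (r t) \<partial>lebesgue_on {0..}) = \<infinity>"
    using r by (auto simp: rate_function_def)
  define M where "M = integral {0..T} r + B"
  have le2: "integral {0..real n} r \<le> M" for n
  proof -
    \<comment> \<open>The maximum with \<open>T\<close> covers the \<open>n\<close> below
      \<open>T\<close>, for which \<open>le\<close> says nothing.\<close>
    have "integral {0..real n} r \<le> integral {0..max T (real n)} r"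
      using \<open>0 \<le> T\<close> by (intro integral_subset_le rate_function_integrable[OF r]) (auto intro: nonneg)
    also have "\<dots> = integral {0..T} r + integral {T..max T (real n)} r"
      using \<open>0 \<le> T\<close> by (intro Henstock_Kurzweil_Integration.integral_combine[symmetric]
          rate_function_integrable[OF r]) auto
    also have "\<dots> \<le> M" using le[of "max T (real n)"] by (simp add: M_def)
    finally show ?thesis .
  qed
  have nn: "(\<integral>\<^sup>+t. ennreal (r t) * indicator {0..real n} t \<partial>lebesgue) \<le> ennreal M" for n
  proof -
    have "r integrable_on {0..real n}"
      by (rule rate_function_integrable[OF r]) simp
    then have "set_integrable lebesgue {0..real n} r"
      using nonneg by (subst absolutely_integrable_on_iff_nonneg) (auto)
    then have "(\<integral>\<^sup>+t. ennreal (indicator {0..real n} t *\<^sub>R r t) \<partial>lebesgue)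
        = ennreal (LINT t:{0..real n}|lebesgue. r t)"
      unfolding set_lebesgue_integral_def set_integrable_def
      by (intro nn_integral_eq_integral) (auto simp: indicator_def nonneg)
    also have "(LINT t:{0..real n}|lebesgue. r t) = integral {0..real n} r"
      using \<open>set_integrable lebesgue {0..real n} r\<close> by (rule set_lebesgue_integral_eq_integral)
    finally have "(\<integral>\<^sup>+t. ennreal (indicator {0..real n} t *\<^sub>R r t) \<partial>lebesgue) \<le> ennreal M"
      using le2[of n] by (simp add: ennreal_leI)
    moreover have "ennreal (indicator {0..real n} t *\<^sub>R r t) = ennreal (r t) * indicator {0..real n} t" for t
      by (auto simp: indicator_def)
    ultimately show ?thesis by simp
  qed
  have "(\<integral>\<^sup>+t. ennreal (r t) \<partial>lebesgue_on {0..})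
      = (\<integral>\<^sup>+t. ennreal (r t) * indicator {0..} t \<partial>lebesgue)"
    by (rule nn_integral_restrict_space) auto
  also have "\<dots> = (\<integral>\<^sup>+t. (SUP n. ennreal (r t) * indicator {0..real n} t) \<partial>lebesgue)"
  proof (intro nn_integral_cong)
    fix t :: real
    show "ennreal (r t) * indicator {0..} t = (SUP n. ennreal (r t) * indicator {0..real n} t)"
    proof (rule antisym)
      obtain n where "t \<le> real n" using real_arch_simple by blast
      then show "ennreal (r t) * indicator {0..} t \<le> (SUP n. ennreal (r t) * indicator {0..real n} t)"
        by (intro SUP_upper2[of n]) (auto simp: indicator_def)
    qed (auto intro!: SUP_least simp: indicator_def)
  qed
  also have "\<dots> = (SUP n. \<integral>\<^sup>+t. ennreal (r t) * indicator {0..real n} t \<partial>lebesgue)"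
  proof (rule nn_integral_monotone_convergence_SUP)
    show "incseq (\<lambda>n t. ennreal (r t) * indicator {0..real n} t)"
      by (auto simp: incseq_def le_fun_def indicator_def)
    fix n
    have "(\<lambda>t. r t * indicator {0..} t) \<in> borel_measurable lebesgue"
      using meas by (simp add: borel_measurable_restrict_space_iff mult.commute)
    then have "(\<lambda>t. ennreal (r t * indicator {0..} t) * indicator {0..real n} t) \<in> borel_measurable lebesgue"
      by (intro borel_measurable_times_ennreal measurable_compose[OF _ measurable_ennreal]
          borel_measurable_indicator) auto
    then show "(\<lambda>t. ennreal (r t) * indicator {0..real n} t) \<in> borel_measurable lebesgue"
      by (rule measurable_cong[THEN iffD1, rotated]) (auto simp: indicator_def)
  qed
  also have "\<dots> \<le> ennreal M" by (intro SUP_least nn)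
  finally show False using inf by (simp add: top_unique)
qed

text \<open>While \<open>z\<close> is positive it loses at least \<open>k\<close> times the integral
  of \<open>r\<close>, which exceeds any initial value in the long run. After the first nonpositive
  value no excursion above 0 can begin, since \<open>z\<close> does not increase where it is
  positive.\<close>

lemma eventually_nonpos:
  fixes z :: "real \<Rightarrow> real"
  assumes r: "rate_function r" and "0 \<le> T" and "k > 0"
    and ac: "\<And>b. abs_continuous_on_interval T b z"
    and deriv: "AE t in lebesgue. T < t \<and> z t > 0 \<longrightarrow>
      (\<exists>D. (z has_real_derivative D) (at t) \<and> D \<le> - k * r t)"
  shows "eventually (\<lambda>t. z t \<le> 0) at_top"
proof -
  have r0: "\<And>t. t \<ge> 0 \<Longrightarrow> r t \<ge> 0"
    using r by (auto simp: rate_function_def)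
  have decrease: "z b \<le> z a - k * integral {a..b} r"
    if "T \<le> a" "a \<le> b" "\<And>t. a < t \<Longrightarrow> t < b \<Longrightarrow> z t > 0" for a b
  proof -
    have "z b - z a \<le> integral {a..b} (\<lambda>t. - k * r t)"
    proof (rule abs_continuous_diff_le)
      show "AE t in lebesgue. a < t \<and> t < b \<longrightarrow>
          (\<exists>D. (z has_real_derivative D) (at t) \<and> D \<le> - k * r t)"
        using deriv by eventually_elim (use that in auto)
      show "abs_continuous_on_interval a b z"
        using abs_continuous_subinterval[OF ac[of b]] that by auto
      show "(\<lambda>t. - k * r t) integrable_on {a..b}"
        using rate_function_integrable[OF r, of a b] that \<open>0 \<le> T\<close> by (intro integrable_on_mult_right) auto
    qed (use that in auto)
    then show ?thesis by simp
  qed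
  have int_nonneg: "integral {a..b} r \<ge> 0" if "T \<le> a" for a b
    using that \<open>0 \<le> T\<close> by (intro integral_nonneg rate_function_integrable[OF r]) (auto intro: r0)
  obtain t1 where t1: "t1 \<ge> T" "z t1 \<le> 0"
  proof (rule ccontr)
    assume "\<not> thesis"
    then have pos: "z t > 0" if "t \<ge> T" for t
      using that \<open>\<And>t1. \<lbrakk>T \<le> t1; z t1 \<le> 0\<rbrakk> \<Longrightarrow> thesis\<close> by (meson not_le)
    obtain b where b: "b \<ge> T" "integral {T..b} r > z T / k"
      using rate_function_integral_unbounded[OF r \<open>0 \<le> T\<close>] by blast
    then have "z b < 0"
      using decrease[of T b] pos \<open>k > 0\<close> by (auto simp: field_simps)
    with pos[of b] b show False by simp
  qed
  have "z t \<le> 0" if "t \<ge> t1" for t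
  proof (rule ccontr)
    assume "\<not> z t \<le> 0"
    \<comment> \<open>\<open>Sup S\<close> is the last time before \<open>t\<close> at which
      \<open>z\<close> is nonpositive; from there to \<open>t\<close> the decrease applies.\<close>
    define S where "S = {t1..t} \<inter> z -` {..0}"
    have "continuous_on {t1..t} z"
      using abs_continuous_imp_continuous_on[OF ac[of t]] t1 continuous_on_subset by fastforce
    then have "closed S"
      unfolding S_def by (intro continuous_closed_preimage) auto
    moreover have "S \<noteq> {}" "bdd_above S"
      using t1 that by (auto simp: S_def)
    ultimately have "Sup S \<in> S"
      by (rule closed_contains_Sup[rotated 2])
    then have s: "t1 \<le> Sup S" "Sup S \<le> t" "z (Sup S) \<le> 0" by (auto simp: S_def)
    have "z u > 0" if "Sup S < u" "u < t" for u
      using that cSup_upper[OF _ \<open>bdd_above S\<close>, of u] s by (force simp: S_def)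
    then have "z t \<le> z (Sup S) - k * integral {Sup S..t} r"
      using s t1 by (intro decrease) auto
    also have "\<dots> \<le> 0"
      using s t1 int_nonneg[of "Sup S" t] \<open>k > 0\<close> by (smt (verit) mult_nonneg_nonneg)
    finally show False using \<open>\<not> z t \<le> 0\<close> by simp
  qed
  then show ?thesis unfolding eventually_at_top_linorder by blast
qed

section \<open>Stieltjes integrals\<close>

text \<open>Monotonicity and right continuity, which \<open>interval_measure\<close> requires, can
  be read off from the infimum.\<close>

lemma mono_right_limit_Inf:
  fixes R :: "real \<Rightarrow> real"
  assumes "mono R"
  shows "Lim (at_right s) R = Inf (R ` {s<..})"
proof -
  have "(R \<longlongrightarrow> Inf (R ` ({s<..} \<inter> UNIV))) (at s within ({s<..} \<inter> UNIV))"
    by (rule Lim_right_bound[where K = "R s"]) (use assms in \<open>auto simp: mono_def\<close>)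
  then show ?thesis by (intro tendsto_Lim) auto
qed

lemma
  fixes R :: "real \<Rightarrow> real"
  assumes "mono R"
  shows right_limit_mono: "u \<le> v \<Longrightarrow> Lim (at_right u) R \<le> Lim (at_right v) R"
    and right_limit_continuous: "continuous (at_right s) (\<lambda>s. Lim (at_right s) R)"
proof -
  let ?F = "\<lambda>s. Inf (R ` {s<..})"
  have bdd: "bdd_below (R ` {s<..})" for s
    using assms by (auto simp: mono_def intro!: bdd_belowI[of _ "R s"])
  have mono: "?F u \<le> ?F v" if "u \<le> v" for u v
    using that by (intro cInf_superset_mono bdd) auto
  then show "u \<le> v \<Longrightarrow> Lim (at_right u) R \<le> Lim (at_right v) R" for u v
    by (simp add: mono_right_limit_Inf[OF assms])
  have "(?F \<longlongrightarrow> ?F s) (at_right s)"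
  proof (rule tendstoI)
    fix e :: real assume "e > 0"
    then obtain u where u: "u > s" "R u < ?F s + e"
      using cInf_lessD[of "R ` {s<..}" "?F s + e"] by auto
    have "dist (?F v) (?F s) < e" if "s < v" "v < u" for v
    proof -
      have "?F v \<le> R u" using that by (intro cInf_lower bdd) auto
      then show ?thesis using mono[of s v] that u by (auto simp: dist_real_def)
    qed
    then show "\<forall>\<^sub>F v in at_right s. dist (?F v) (?F s) < e"
      using u by (auto simp: eventually_at_right_field)
  qed
  then show "continuous (at_right s) (\<lambda>s. Lim (at_right s) R)"
    by (simp add: continuous_within mono_right_limit_Inf[OF assms])
qed

section \<open>Total mass and mean values of the Stieltjes measure\<close>

lemma sets_stieltjes_measure [simp, measurable_cong]: "sets (stieltjes_measure R) = sets borel"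
  by (simp add: stieltjes_measure_def)

text \<open>\<open>interval_measure\<close> evaluates half-open intervals open on the left, but the
  atom at \<open>h\<close> belongs to the integral. Hence \<open>{h..t}\<close> is taken as the
  intersection of intervals \<open>{s<..t}\<close> with \<open>s\<close> increasing to
  \<open>h\<close>, all of mass 1.\<close>

lemma emeasure_stieltjes_measure_Icc:
  assumes "mono R" "h \<le> t" "\<And>s. s \<le> h \<Longrightarrow> R s = 0" "(R \<longlongrightarrow> 1) (at_right t)"
  shows "emeasure (stieltjes_measure R) {h..t} = 1"
proof -
  let ?F = "\<lambda>s. Lim (at_right s) R"
  have Ft: "?F t = 1"
    using assms(4) by (intro tendsto_Lim) auto
  \<comment> \<open>Only strictly below \<open>h\<close>: at \<open>h\<close> itself the right limit
    is the mass of the atom there.\<close>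
  have F0: "?F s = 0" if "s < h" for s
  proof -
    have "\<forall>\<^sub>F u in at_right s. R u = 0"
      using that assms(3) by (auto simp: eventually_at_right_field intro!: exI[of _ h])
    then have "(R \<longlongrightarrow> 0) (at_right s)" by (simp add: tendsto_eventually)
    then show ?thesis by (intro tendsto_Lim) auto
  qed
  have Ioc: "emeasure (stieltjes_measure R) {s<..t} = 1" if "s < h" for s
    unfolding stieltjes_measure_def
    using that assms(1,2) F0[OF that] Ft
    by (subst emeasure_interval_measure_Ioc)
      (auto intro: right_limit_mono right_limit_continuous)
  define A where "A = (\<lambda>n. {h - 1 / real (Suc n)<..t})"
  have "(INF n. emeasure (stieltjes_measure R) (A n)) = emeasure (stieltjes_measure R) (\<Inter>n. A n)"
  proof (rule INF_emeasure_decseq)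
    show "decseq A"
      unfolding decseq_def
    proof (intro allI impI subsetI)
      fix m n :: nat and s assume "m \<le> n" "s \<in> A n"
      moreover from \<open>m \<le> n\<close> have "h - 1 / real (Suc m) \<le> h - 1 / real (Suc n)"
        by (intro diff_left_mono divide_left_mono) auto
      ultimately show "s \<in> A m"
        unfolding A_def greaterThanAtMost_iff by (blast intro: le_less_trans)
    qed
  qed (auto simp: A_def Ioc)
  moreover have "(\<Inter>n. A n) = {h..t}"
  proof (intro set_eqI iffI)
    fix s assume s: "s \<in> (\<Inter>n. A n)"
    have "h \<le> s"
    proof (rule ccontr)
      assume "\<not> h \<le> s"
      then obtain n where "inverse (real (Suc n)) < h - s"
        using reals_Archimedean[of "h - s"] by auto
      moreover have "s \<in> A n" using s by blast
      ultimately show False by (auto simp: A_def inverse_eq_divide)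
    qed
    then show "s \<in> {h..t}" using s by (auto simp: A_def)
  next
    fix s assume "s \<in> {h..t}"
    then show "s \<in> (\<Inter>n. A n)" by (auto simp: A_def intro: less_le_trans[rotated])
  qed
  ultimately show ?thesis by (simp add: A_def Ioc)
qed

lemma stieltjes_integral_bounds:
  assumes R: "mono R" "h \<le> t" "\<And>s. s \<le> h \<Longrightarrow> R s = 0" "(R \<longlongrightarrow> 1) (at_right t)"
    and g: "continuous_on UNIV g"
  shows stieltjes_integral_le: "(\<And>s. h \<le> s \<Longrightarrow> s \<le> t \<Longrightarrow> g s \<le> B) \<Longrightarrow> stieltjes_integral R h t g \<le> B"
    and stieltjes_integral_ge: "(\<And>s. h \<le> s \<Longrightarrow> s \<le> t \<Longrightarrow> B \<le> g s) \<Longrightarrow> B \<le> stieltjes_integral R h t g"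
proof -
  let ?M = "stieltjes_measure R"
  note [simp] = emeasure_stieltjes_measure_Icc[OF R]
  have meas: "measure ?M {h..t} = 1" by (simp add: measure_def)
  have gm: "g \<in> borel_measurable ?M"
    using borel_measurable_continuous_onI[OF g]
    by (simp add: measurable_def sets_eq_imp_space_eq[OF sets_stieltjes_measure])
  have "compact (g ` {h..t})"
    by (intro compact_continuous_image continuous_on_subset[OF g]) auto
  then obtain C where C: "\<And>s. s \<in> {h..t} \<Longrightarrow> norm (g s) \<le> C"
    by (meson bounded_iff compact_imp_bounded image_eqI)
  have int: "set_integrable ?M {h..t} g"
    unfolding set_integrable_def
    by (rule integrableI_bounded_set_indicator[where B = C]) (use gm C in auto)
  have intc: "set_integrable ?M {h..t} (\<lambda>_. B)" for B :: real
    unfolding set_integrable_def by (rule integrable_scaleR_left) (auto simp: integrable_indicator_iff)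
  have const: "(LINT s:{h..t}|?M. B) = B" for B :: real
    using meas by (simp add: set_lebesgue_integral_def)
  show "stieltjes_integral R h t g \<le> B" if "\<And>s. h \<le> s \<Longrightarrow> s \<le> t \<Longrightarrow> g s \<le> B"
    using set_integral_mono[OF int intc[of B]] that const[of B]
    by (simp add: stieltjes_integral_def)
  show "B \<le> stieltjes_integral R h t g" if "\<And>s. h \<le> s \<Longrightarrow> s \<le> t \<Longrightarrow> B \<le> g s"
    using set_integral_mono[OF intc[of B] int] that const[of B]
    by (simp add: stieltjes_integral_def)
qed

section \<open>One delayed equation\<close>

lemma feedback_function_nonneg: "feedback_function f \<Longrightarrow> 0 \<le> u \<Longrightarrow> 0 \<le> f u"
  by (auto simp: feedback_function_def)

lemma feedback_function_mono: "feedback_function f \<Longrightarrow> 0 \<le> u \<Longrightarrow> u \<le> v \<Longrightarrow> f u \<le> f v"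
  by (auto simp: feedback_function_def strict_mono_on_def le_less)

lemma feedback_function_strict_mono: "feedback_function f \<Longrightarrow> 0 \<le> u \<Longrightarrow> u < v \<Longrightarrow> f u < f v"
  by (auto simp: feedback_function_def strict_mono_on_def)

text \<open>Here \<open>y\<close> is just a given nonnegative continuous input. Both equations of
  the system are instances, with the roles of \<open>x\<close> and \<open>y\<close> exchanged. The
  conditions on \<open>y\<close> concern the whole line because the delay may reach into negative
  times.\<close>

locale delayed_equation =
  fixes r G f h x y :: "real \<Rightarrow> real" and R :: "real \<Rightarrow> real \<Rightarrow> real"
  assumes rate: "rate_function r" and gain: "gain_function G" and feedback: "feedback_function f"
    and delay: "delay_function h" and dist: "delay_distribution h R"
    and x_ac: "locally_abs_continuous x"
    and x_nonneg: "\<And>t. t \<ge> 0 \<Longrightarrow> x t \<ge> 0"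
    and y_cont: "continuous_on UNIV y" and y_nonneg: "\<And>t. y t \<ge> 0"
    and deriv: "AE t in lebesgue. t \<ge> 0 \<longrightarrow>
      (x has_real_derivative
         r t * G (x t) * (stieltjes_integral (R t) (h t) t (\<lambda>s. f (y s)) - x t)) (at t)"
begin

abbreviation input :: "real \<Rightarrow> real" where
  "input t \<equiv> stieltjes_integral (R t) (h t) t (\<lambda>s. f (y s))"

lemma rate_nonneg: "t \<ge> 0 \<Longrightarrow> r t \<ge> 0"
  using rate by (auto simp: rate_function_def)

lemma gain_nonneg: "u \<ge> 0 \<Longrightarrow> G u \<ge> 0"
  using gain by (auto simp: gain_function_def)

lemma x_ac_on: "0 \<le> p \<Longrightarrow> abs_continuous_on_interval p q x"
  using x_ac[unfolded locally_abs_continuous_def, rule_format, of "max q 1"]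
  by (rule abs_continuous_subinterval) auto

lemma x_cont: "continuous_on {0..q} x"
  by (rule abs_continuous_imp_continuous_on[OF x_ac_on]) simp

lemma x_cont_atLeast: "continuous_on {0..} x"
proof -
  have "continuous (at t within {0..}) x" if "t \<ge> 0" for t
  proof -
    have "continuous (at t within {0..t + 1}) x"
      using x_cont[of "t + 1"] that by (auto simp: continuous_on_eq_continuous_within)
    moreover have "at t within {0..t + 1} = at t within {0..}"
      by (rule at_within_nhd[of _ "{..<t + 1}"]) auto
    ultimately show ?thesis by simp
  qed
  then show ?thesis by (auto simp: continuous_on_eq_continuous_within)
qed

lemma
  assumes "t \<ge> 0"
  shows input_le: "b \<ge> 0 \<Longrightarrow> (\<And>s. h t \<le> s \<Longrightarrow> s \<le> t \<Longrightarrow> y s \<le> b) \<Longrightarrow> input t \<le> f b"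
    and input_ge: "b \<ge> 0 \<Longrightarrow> (\<And>s. h t \<le> s \<Longrightarrow> s \<le> t \<Longrightarrow> b \<le> y s) \<Longrightarrow> f b \<le> input t"
proof -
  have R: "mono (R t)" "h t \<le> t" "\<And>s. s \<le> h t \<Longrightarrow> R t s = 0" "(R t \<longlongrightarrow> 1) (at_right t)"
    using dist delay assms by (auto simp: delay_distribution_def delay_function_def)
  have cont: "continuous_on UNIV (\<lambda>s. f (y s))"
    using feedback y_nonneg
    by (intro continuous_on_compose2[OF _ y_cont, of "{0..}" f]) (auto simp: feedback_function_def)
  show "input t \<le> f b" if "b \<ge> 0" "\<And>s. h t \<le> s \<Longrightarrow> s \<le> t \<Longrightarrow> y s \<le> b"
    by (rule stieltjes_integral_le[OF R cont])
      (use that y_nonneg in \<open>auto intro!: feedback_function_mono[OF feedback]\<close>)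
  show "f b \<le> input t" if "b \<ge> 0" "\<And>s. h t \<le> s \<Longrightarrow> s \<le> t \<Longrightarrow> b \<le> y s"
    by (rule stieltjes_integral_ge[OF R cont])
      (use that y_nonneg in \<open>auto intro!: feedback_function_mono[OF feedback]\<close>)
qed

text \<open>This supplies the constant \<open>K\<close> of \<open>stay_positive\<close>:
  \<open>r\<close> is essentially bounded and \<open>G\<close> is bounded along the compact piece of
  the solution.\<close>

lemma gain_on_bounded:
  assumes "0 \<le> p"
  obtains K where "K \<ge> 0"
    "AE t in lebesgue. p \<le> t \<and> t \<le> q \<longrightarrow> 0 \<le> r t * G (x t) \<and> r t * G (x t) \<le> K"
proof -
  obtain C where C: "AE t in lebesgue. t \<in> {0..} \<longrightarrow> \<bar>r t\<bar> \<le> C"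
    using rate by (auto simp: rate_function_def AE_restrict_space_iff)
  have "continuous_on {0..q} (\<lambda>t. G (x t))"
    using gain x_nonneg
    by (intro continuous_on_compose2[OF _ x_cont, of "{0..}" G]) (auto simp: gain_function_def)
  then have "bounded ((\<lambda>t. G (x t)) ` {0..q})"
    by (intro compact_imp_bounded compact_continuous_image) auto
  then obtain M where M: "\<And>t. t \<in> {0..q} \<Longrightarrow> \<bar>G (x t)\<bar> \<le> M"
    unfolding bounded_iff real_norm_def by blast
  show thesis
  proof (rule that[of "\<bar>C\<bar> * \<bar>M\<bar>"])
    show "AE t in lebesgue. p \<le> t \<and> t \<le> q \<longrightarrow>
        0 \<le> r t * G (x t) \<and> r t * G (x t) \<le> \<bar>C\<bar> * \<bar>M\<bar>"
      using C
    proof eventually_elim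
      case (elim t)
      show ?case
      proof (intro impI conjI)
        assume t: "p \<le> t \<and> t \<le> q"
        then show "0 \<le> r t * G (x t)"
          using assms rate_nonneg x_nonneg gain_nonneg by simp
        show "r t * G (x t) \<le> \<bar>C\<bar> * \<bar>M\<bar>"
          using t assms elim M[of t] rate_nonneg[of t] gain_nonneg[of "x t"] x_nonneg[of t]
          by (intro mult_mono) auto
      qed
    qed
  qed simp
qed

text \<open>The input is at most \<open>f b\<close>, hence at most \<open>a\<close>, so z = a - x
  satisfies z' >= -r G z >= -K z and cannot reach 0 at time \<open>q\<close>. Equality
  \<open>f b = a\<close> is harmless.\<close>

lemma barrier_above:
  assumes "0 \<le> p" "p < q" "\<And>t. p \<le> t \<Longrightarrow> t < q \<Longrightarrow> x t < a"
    and "0 \<le> b" "f b \<le> a" and y: "\<And>t s. p \<le> t \<Longrightarrow> t < q \<Longrightarrow> h t \<le> s \<Longrightarrow> s \<le> t \<Longrightarrow> y s \<le> b"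
  shows "x q < a"
proof -
  obtain K where K: "K \<ge> 0"
    "AE t in lebesgue. p \<le> t \<and> t \<le> q \<longrightarrow> 0 \<le> r t * G (x t) \<and> r t * G (x t) \<le> K"
    using gain_on_bounded[OF assms(1)] by blast
  have "0 < a + - 1 * x q"
  proof (rule stay_positive[OF assms(2)])
    show "abs_continuous_on_interval p q (\<lambda>t. a + - 1 * x t)"
      by (intro abs_continuous_affine x_ac_on assms)
    show "AE t in lebesgue. p < t \<and> t < q \<longrightarrow>
      (\<exists>D. ((\<lambda>t. a + - 1 * x t) has_real_derivative D) (at t) \<and> - K * (a + - 1 * x t) \<le> D)"
      using K(2) deriv
    proof eventually_elim
      case (elim t)
      show ?case
      proof
        assume t: "p < t \<and> t < q"
        let ?k = "r t * G (x t)"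
        have "?k * (input t - x t) \<le> ?k * (a - x t)"
          using input_le[of t b] y[of t] t assms elim(1) by (intro mult_left_mono) auto
        also have "\<dots> \<le> K * (a - x t)"
          using elim(1) t assms(3)[of t] by (intro mult_right_mono) auto
        finally have "- K * (a + - 1 * x t) \<le> - (?k * (input t - x t))" by simp
        moreover have "((\<lambda>t. a + - 1 * x t) has_real_derivative - (?k * (input t - x t))) (at t)"
          using elim(2) t assms(1) by (auto intro!: derivative_eq_intros)
        ultimately show "\<exists>D. ((\<lambda>t. a + - 1 * x t) has_real_derivative D) (at t) \<and>
            - K * (a + - 1 * x t) \<le> D"
          by blast
      qed
    qed
  qed (use K assms in auto)
  then show ?thesis by simp
qed

lemma barrier_below:
  assumes "0 \<le> p" "p < q" "\<And>t. p \<le> t \<Longrightarrow> t < q \<Longrightarrow> a < x t"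
    and "0 \<le> b" "a \<le> f b" and y: "\<And>t s. p \<le> t \<Longrightarrow> t < q \<Longrightarrow> h t \<le> s \<Longrightarrow> s \<le> t \<Longrightarrow> b \<le> y s"
  shows "a < x q"
proof -
  obtain K where K: "K \<ge> 0"
    "AE t in lebesgue. p \<le> t \<and> t \<le> q \<longrightarrow> 0 \<le> r t * G (x t) \<and> r t * G (x t) \<le> K"
    using gain_on_bounded[OF assms(1)] by blast
  have "0 < - a + 1 * x q"
  proof (rule stay_positive[OF assms(2)])
    show "abs_continuous_on_interval p q (\<lambda>t. - a + 1 * x t)"
      by (intro abs_continuous_affine x_ac_on assms)
    show "AE t in lebesgue. p < t \<and> t < q \<longrightarrow>
      (\<exists>D. ((\<lambda>t. - a + 1 * x t) has_real_derivative D) (at t) \<and> - K * (- a + 1 * x t) \<le> D)"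
      using K(2) deriv
    proof eventually_elim
      case (elim t)
      show ?case
      proof
        assume t: "p < t \<and> t < q"
        let ?k = "r t * G (x t)"
        have "?k * (x t - input t) \<le> ?k * (x t - a)"
          using input_ge[of t b] y[of t] t assms elim(1) by (intro mult_left_mono) auto
        also have "\<dots> \<le> K * (x t - a)"
          using elim(1) t assms(3)[of t] by (intro mult_right_mono) auto
        finally have "- K * (- a + 1 * x t) \<le> ?k * (input t - x t)"
          by (simp add: algebra_simps)
        moreover have "((\<lambda>t. - a + 1 * x t) has_real_derivative ?k * (input t - x t)) (at t)"
          using elim(2) t assms(1) by (auto intro!: derivative_eq_intros)
        ultimately show "\<exists>D. ((\<lambda>t. - a + 1 * x t) has_real_derivative D) (at t) \<and>
            - K * (- a + 1 * x t) \<le> D"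
          by blast
      qed
    qed
  qed (use K assms in auto)
  then show ?thesis by simp
qed

section \<open>From eventual bounds on the input to eventual bounds on the solution\<close>

lemma gain_bounded_below:
  assumes "0 < m" "m \<le> M"
  obtains g where "g > 0" "\<And>u. m \<le> u \<Longrightarrow> u \<le> M \<Longrightarrow> g \<le> G u"
proof -
  have "continuous_on {m..M} G"
    using gain assms by (auto simp: gain_function_def intro: continuous_on_subset)
  then obtain u where "u \<in> {m..M}" "\<And>v. v \<in> {m..M} \<Longrightarrow> G u \<le> G v"
    using continuous_attains_inf[of "{m..M}" G] assms by auto
  then show thesis
    using gain assms by (intro that[of "G u"]) (auto simp: gain_function_def)
qed

lemma eventually_delayed:
  assumes "eventually P at_top"
  shows "eventually (\<lambda>t. \<forall>s. h t \<le> s \<longrightarrow> P s) at_top"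
proof -
  obtain N where N: "\<And>s. s \<ge> N \<Longrightarrow> P s"
    using assms by (auto simp: eventually_at_top_linorder)
  have "eventually (\<lambda>t. N \<le> h t) at_top"
    using delay by (auto simp: delay_function_def filterlim_at_top)
  then show ?thesis
    by eventually_elim (auto intro: N)
qed

text \<open>While x > c, the value of x lies in [c, M], where \<open>G\<close> has a positive
  minimum \<open>g\<close>, and x exceeds the input by at least \<open>c - f b\<close>. So x - c
  falls at least at the rate \<open>g * (c - f b) * r t\<close>.\<close>

lemma eventually_x_le:
  assumes y: "eventually (\<lambda>t. y t \<le> b) at_top" and "b \<ge> 0" and "f b < c"
    and x: "eventually (\<lambda>t. x t \<le> M) at_top"
  shows "eventually (\<lambda>t. x t \<le> c) at_top"
proof -
  have "c > 0"
    using feedback_function_nonneg[OF feedback \<open>b \<ge> 0\<close>] \<open>f b < c\<close> by simp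
  then obtain g where "g > 0" and g: "\<And>u. c \<le> u \<Longrightarrow> u \<le> max c M \<Longrightarrow> g \<le> G u"
    using gain_bounded_below[of c "max c M"] by auto
  have "eventually (\<lambda>t. 0 \<le> t \<and> x t \<le> M \<and> (\<forall>s. h t \<le> s \<longrightarrow> y s \<le> b)) at_top"
    using eventually_delayed[OF y] x eventually_ge_at_top[of 0] by eventually_elim auto
  then obtain T where T: "0 \<le> T" "\<And>t. t \<ge> T \<Longrightarrow> x t \<le> M" "\<And>t s. t \<ge> T \<Longrightarrow> h t \<le> s \<Longrightarrow> y s \<le> b"
    unfolding eventually_at_top_linorder by (metis order_refl)
  have "eventually (\<lambda>t. - c + 1 * x t \<le> 0) at_top"
  proof (rule eventually_nonpos[OF rate T(1)])
    show "g * (c - f b) > 0" using \<open>g > 0\<close> \<open>f b < c\<close> by simp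
    show "abs_continuous_on_interval T q (\<lambda>t. - c + 1 * x t)" for q
      by (intro abs_continuous_affine x_ac_on T)
    show "AE t in lebesgue. T < t \<and> 0 < - c + 1 * x t \<longrightarrow>
      (\<exists>D. ((\<lambda>t. - c + 1 * x t) has_real_derivative D) (at t) \<and> D \<le> - (g * (c - f b)) * r t)"
      using deriv
    proof eventually_elim
      case (elim t)
      show ?case
      proof
        assume t: "T < t \<and> 0 < - c + 1 * x t"
        then have "t \<ge> 0" using T by simp
        have "input t \<le> f b"
          by (rule input_le[OF \<open>t \<ge> 0\<close> \<open>b \<ge> 0\<close>]) (use T(3)[of t] t in auto)
        have "g * (c - f b) \<le> G (x t) * (x t - input t)"
          using \<open>input t \<le> f b\<close> t T(2)[of t] \<open>g > 0\<close> \<open>f b < c\<close> \<open>c > 0\<close>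
          by (intro mult_mono g) (auto intro: gain_nonneg)
        then have "r t * (g * (c - f b)) \<le> r t * (G (x t) * (x t - input t))"
          using rate_nonneg[OF \<open>t \<ge> 0\<close>] by (rule mult_left_mono)
        then have "r t * G (x t) * (input t - x t) \<le> - (g * (c - f b)) * r t"
          by (simp add: algebra_simps)
        moreover have "((\<lambda>t. - c + 1 * x t) has_real_derivative
            r t * G (x t) * (input t - x t)) (at t)"
          using elim \<open>t \<ge> 0\<close> by (auto intro!: derivative_eq_intros)
        ultimately show "\<exists>D. ((\<lambda>t. - c + 1 * x t) has_real_derivative D) (at t) \<and>
            D \<le> - (g * (c - f b)) * r t"
          by blast
      qed
    qed
  qed
  then show ?thesis by simp
qed

text \<open>Below \<open>c\<close> the gain is bounded away from 0 only because x stays above the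
  positive number \<open>m\<close>. As \<open>c\<close> is arbitrary, \<open>max c m\<close> keeps
  the interval nonempty.\<close>

lemma eventually_x_ge:
  assumes y: "eventually (\<lambda>t. b \<le> y t) at_top" and "b \<ge> 0" and "c < f b"
    and "0 < m" and x: "eventually (\<lambda>t. m \<le> x t) at_top"
  shows "eventually (\<lambda>t. c \<le> x t) at_top"
proof -
  obtain g where "g > 0" and g: "\<And>u. m \<le> u \<Longrightarrow> u \<le> max c m \<Longrightarrow> g \<le> G u"
    using gain_bounded_below[of m "max c m"] \<open>0 < m\<close> by auto
  have "eventually (\<lambda>t. 0 \<le> t \<and> m \<le> x t \<and> (\<forall>s. h t \<le> s \<longrightarrow> b \<le> y s)) at_top"
    using eventually_delayed[OF y] x eventually_ge_at_top[of 0] by eventually_elim auto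
  then obtain T where T: "0 \<le> T" "\<And>t. t \<ge> T \<Longrightarrow> m \<le> x t" "\<And>t s. t \<ge> T \<Longrightarrow> h t \<le> s \<Longrightarrow> b \<le> y s"
    unfolding eventually_at_top_linorder by (metis order_refl)
  have "eventually (\<lambda>t. c + - 1 * x t \<le> 0) at_top"
  proof (rule eventually_nonpos[OF rate T(1)])
    show "g * (f b - c) > 0" using \<open>g > 0\<close> \<open>c < f b\<close> by simp
    show "abs_continuous_on_interval T q (\<lambda>t. c + - 1 * x t)" for q
      by (intro abs_continuous_affine x_ac_on T)
    show "AE t in lebesgue. T < t \<and> 0 < c + - 1 * x t \<longrightarrow>
      (\<exists>D. ((\<lambda>t. c + - 1 * x t) has_real_derivative D) (at t) \<and> D \<le> - (g * (f b - c)) * r t)"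
      using deriv
    proof eventually_elim
      case (elim t)
      show ?case
      proof
        assume t: "T < t \<and> 0 < c + - 1 * x t"
        then have "t \<ge> 0" using T by simp
        have "f b \<le> input t"
          by (rule input_ge[OF \<open>t \<ge> 0\<close> \<open>b \<ge> 0\<close>]) (use T(3)[of t] t in auto)
        have "g * (f b - c) \<le> G (x t) * (input t - x t)"
          using \<open>f b \<le> input t\<close> t T(2)[of t] \<open>g > 0\<close> \<open>c < f b\<close> \<open>0 < m\<close>
          by (intro mult_mono g) (auto intro: gain_nonneg)
        then have "r t * (g * (f b - c)) \<le> r t * (G (x t) * (input t - x t))"
          using rate_nonneg[OF \<open>t \<ge> 0\<close>] by (rule mult_left_mono)
        then have "- (r t * G (x t) * (input t - x t)) \<le> - (g * (f b - c)) * r t"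
          by (simp add: algebra_simps)
        moreover have "((\<lambda>t. c + - 1 * x t) has_real_derivative
            - (r t * G (x t) * (input t - x t))) (at t)"
          using elim \<open>t \<ge> 0\<close> by (auto intro!: derivative_eq_intros)
        ultimately show "\<exists>D. ((\<lambda>t. c + - 1 * x t) has_real_derivative D) (at t) \<and>
            D \<le> - (g * (f b - c)) * r t"
          by blast
      qed
    qed
  qed
  then show ?thesis by simp
qed

text \<open>The barrier at level 0, with 0 as lower bound of \<open>y\<close>: the input is at least
  \<open>f 0\<close>, which is nonnegative.\<close>

lemma x_pos:
  assumes "x 0 > 0" "t \<ge> 0"
  shows "x t > 0"
proof (rule continuous_induction_pos[OF x_cont_atLeast])
  fix q :: real assume "0 < q" "\<And>t. 0 \<le> t \<Longrightarrow> t < q \<Longrightarrow> 0 < x t"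
  then show "0 < x q"
    using feedback_function_nonneg[OF feedback, of 0] y_nonneg
    by (intro barrier_below[of 0 q 0 0]) auto
qed (use assms in auto)

end

section \<open>The coupled system\<close>

lemma continuous_less_right:
  fixes f :: "real \<Rightarrow> real"
  assumes "continuous_on {0..} f" "0 \<le> p" "f p < c"
  obtains q where "p < q" "f q < c"
proof -
  have "(f \<longlongrightarrow> f p) (at p within {0..})"
    using assms by (auto simp: continuous_on_def)
  then have "(f \<longlongrightarrow> f p) (at_right p)"
    by (rule tendsto_within_subset) (use assms in auto)
  then have "\<forall>\<^sub>F q in at_right p. f q < c"
    using assms(3) by (rule order_tendstoD)
  with eventually_at_right_less[of p] have "\<forall>\<^sub>F q in at_right p. p < q \<and> f q < c"
    by (rule eventually_conj)
  then show thesis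
    using that eventually_happens'[OF trivial_limit_at_right_real] by blast
qed

lemma continuous_greater_left:
  fixes f :: "real \<Rightarrow> real"
  assumes "continuous_on {0..} f" "0 < p" "c < f p"
  obtains q where "0 < q" "q < p" "c < f q"
proof -
  have "(f \<longlongrightarrow> f p) (at p within {0..})"
    using assms by (auto simp: continuous_on_def)
  then have "(f \<longlongrightarrow> f p) (at p within {0..p})"
    by (rule tendsto_within_subset) auto
  then have "(f \<longlongrightarrow> f p) (at_left p)"
    by (simp add: at_within_Icc_at_left[OF \<open>0 < p\<close>])
  then have "\<forall>\<^sub>F q in at_left p. c < f q"
    using assms(3) by (rule order_tendstoD)
  moreover have "\<forall>\<^sub>F q in at_left p. 0 < q \<and> q < p"
    using \<open>0 < p\<close> by (auto simp: eventually_at_left_field)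
  ultimately have "\<forall>\<^sub>F q in at_left p. c < f q \<and> 0 < q \<and> q < p"
    by (rule eventually_conj)
  then show thesis
    using that eventually_happens'[OF trivial_limit_at_left_real] by blast
qed

text \<open>The infimum of the bounds need not be a bound itself. If it is positive,
  \<open>g\<close> maps it strictly below itself, and by continuity also some point just above it,
  which is a bound; \<open>step\<close> then gives a bound below the infimum.\<close>

lemma upper_bounds_shrink:
  fixes g :: "real \<Rightarrow> real"
  assumes g: "continuous_on {0..} g" "\<And>z. z > 0 \<Longrightarrow> g z < z"
    and mono: "\<And>a c. P a \<Longrightarrow> a \<le> c \<Longrightarrow> P c" and "P a0" "a0 > 0"
    and step: "\<And>a c. a > 0 \<Longrightarrow> P a \<Longrightarrow> g a < c \<Longrightarrow> P c"
    and "c > 0"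
  shows "P c"
proof -
  define S where "S = {c. c > 0 \<and> P c}"
  have S: "S \<noteq> {}" "bdd_below S"
    using assms(4,5) by (auto simp: S_def intro!: bdd_belowI[of _ 0])
  have above: "P a" if "Inf S < a" for a
    using cInf_lessD[OF S(1) that] mono by (auto simp: S_def)
  have "Inf S \<ge> 0"
    using S by (intro cInf_greatest) (auto simp: S_def)
  have "\<not> Inf S > 0"
  proof
    assume pos: "Inf S > 0"
    \<comment> \<open>The maximum with 0 keeps \<open>c\<close> positive, as membership in
      \<open>S\<close> demands.\<close>
    then obtain c where c: "max 0 (g (Inf S)) < c" "c < Inf S"
      using g(2)[OF pos] dense[of "max 0 (g (Inf S))" "Inf S"] by auto
    then obtain a where "Inf S < a" "g a < c"
      using continuous_less_right[OF g(1), of "Inf S" c] pos by auto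
    then have "c \<in> S"
      using above step[of a c] c pos by (auto simp: S_def)
    then show False using cInf_lower[OF _ S(2)] c by force
  qed
  then show ?thesis using above \<open>c > 0\<close> by simp
qed

lemma lower_bounds_grow:
  fixes g :: "real \<Rightarrow> real"
  assumes g: "continuous_on {0..} g" "\<And>z. z > 0 \<Longrightarrow> z < g z"
    and mono: "\<And>a c. P a \<Longrightarrow> c \<le> a \<Longrightarrow> P c" and "P a0" "a0 > 0"
    and step: "\<And>a c. a > 0 \<Longrightarrow> P a \<Longrightarrow> c < g a \<Longrightarrow> P c"
  shows "P c"
proof (rule ccontr)
  assume "\<not> P c"
  define S where "S = {c. c > 0 \<and> P c}"
  \<comment> \<open>A member of \<open>S\<close> above \<open>c\<close> would yield
    \<open>P c\<close> by monotonicity, so the assumption \<open>\<not> P c\<close> makes the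
    supremum finite.\<close>
  have S: "S \<noteq> {}" "bdd_above S"
    using assms(4,5) mono \<open>\<not> P c\<close> by (auto simp: S_def intro!: bdd_aboveI[of _ c]) (meson linear)
  have below: "P a" if "a < Sup S" for a
    using less_cSupD[OF S(1) that] mono by (auto simp: S_def)
  have pos: "Sup S > 0"
    using cSup_upper[OF _ S(2), of a0] assms(4,5) by (auto simp: S_def)
  then obtain c where c: "Sup S < c" "c < g (Sup S)"
    using g(2) dense by blast
  then obtain a where "0 < a" "a < Sup S" "c < g a"
    using continuous_greater_left[OF g(1) pos] by blast
  then have "c \<in> S"
    using below step[of a c] c pos by (auto simp: S_def)
  then show False using cSup_upper[OF _ S(2)] c by force
qed

locale coupled_system =
  eq1: delayed_equation r1 G1 f1 h1 x y R1 + eq2: delayed_equation r2 G2 f2 h2 y x R2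
  for r1 r2 G1 G2 f1 f2 h1 h2 x y :: "real \<Rightarrow> real" and R1 R2 :: "real \<Rightarrow> real \<Rightarrow> real" +
  assumes x0: "x 0 > 0" and y0: "y 0 > 0"
    and initial_bounded: "bounded (x ` {..0})" "bounded (y ` {..0})"
begin

text \<open>By this symmetry the limits need to be proved for \<open>x\<close> only.\<close>

lemma swap: "coupled_system r2 r1 G2 G1 f2 f1 h2 h1 y x R2 R1"
  using x0 y0 initial_bounded
  by (intro coupled_system.intro coupled_system_axioms.intro
      eq1.delayed_equation_axioms eq2.delayed_equation_axioms)

lemma composition_continuous: "continuous_on {0..} (\<lambda>z. f1 (f2 z))"
  using eq1.feedback eq2.feedback
  by (auto simp: feedback_function_def intro!: continuous_on_compose2[of "{0..}" f1 "{0..}" f2])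

lemma eventually_bounded_above:
  assumes "\<And>z. z > 0 \<Longrightarrow> f1 (f2 z) < z" "\<And>z. z > 0 \<Longrightarrow> f2 (f1 z) < z"
  shows "\<exists>a>0. eventually (\<lambda>t. x t \<le> a) at_top"
    and "\<exists>b>0. eventually (\<lambda>t. y t \<le> b) at_top"
proof -
  obtain A B where AB: "\<And>t. t \<le> 0 \<Longrightarrow> \<bar>x t\<bar> \<le> A" "\<And>t. t \<le> 0 \<Longrightarrow> \<bar>y t\<bar> \<le> B"
    using initial_bounded unfolding bounded_iff real_norm_def by (meson atMost_iff imageI)
  \<comment> \<open>The added 1 makes the initial values strictly smaller than the bounds and the
    bounds positive.\<close>
  define a0 where "a0 = \<bar>A\<bar> + 1"
  define b0 where "b0 = \<bar>B\<bar> + 1"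
  have pos: "a0 > 0" "b0 > 0" by (auto simp: a0_def b0_def)
  have init: "x t < a0" "y t < b0" if "t \<le> 0" for t
    using AB[OF that] by (auto simp: a0_def b0_def)
  define a where "a = max a0 (f1 b0)"
  define b where "b = max b0 (f2 a0)"
  \<comment> \<open>If \<open>b\<close> is \<open>b0\<close>, then \<open>f1 b \<le> a\<close> by
    the choice of \<open>a\<close>; if \<open>b\<close> is \<open>f2 a0\<close>, then
    \<open>f1 b < a0\<close> by assumption. The other inequality is symmetric.\<close>
  have ab: "f1 b \<le> a" "f2 a \<le> b"
    using assms(1)[of a0] assms(2)[of b0] pos by (auto simp: a_def b_def max_def)
  define w where "w = (\<lambda>t. min (a - x t) (b - y t))"
  have w: "w t > 0" if "t \<ge> 0" for t
  proof (rule continuous_induction_pos[OF _ _ _ that])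
    show "continuous_on {0..} w"
      unfolding w_def by (intro continuous_intros eq1.x_cont_atLeast eq2.x_cont_atLeast)
    show "w 0 > 0"
      using init[of 0] by (auto simp: w_def a_def b_def)
    fix q :: real assume q: "0 < q" and less: "\<And>t. 0 \<le> t \<Longrightarrow> t < q \<Longrightarrow> 0 < w t"
    \<comment> \<open>All \<open>s < q\<close> are covered, negative ones through
      \<open>init\<close>, since the delays may reach arbitrarily far back.\<close>
    have le: "x s < a" "y s < b" if "s < q" for s
      using less[of s] init[of s] that by (cases "s \<ge> 0"; force simp: w_def a_def b_def)+
    have "x q < a"
      by (rule eq1.barrier_above[of 0 q a b]) (use q ab le pos in \<open>auto simp: b_def less_imp_le\<close>)
    moreover have "y q < b"
      by (rule eq2.barrier_above[of 0 q b a]) (use q ab le pos in \<open>auto simp: a_def less_imp_le\<close>)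
    ultimately show "w q > 0" by (simp add: w_def)
  qed
  show "\<exists>a>0. eventually (\<lambda>t. x t \<le> a) at_top"
    using w pos by (intro exI[of _ a] conjI eventually_at_top_linorderI[of 0])
      (auto simp: w_def a_def intro: less_imp_le)
  show "\<exists>b>0. eventually (\<lambda>t. y t \<le> b) at_top"
    using w pos by (intro exI[of _ b] conjI eventually_at_top_linorderI[of 0])
      (auto simp: w_def b_def intro: less_imp_le)
qed

lemma eventually_bounded_below:
  assumes "\<And>z. z > 0 \<Longrightarrow> z < f1 (f2 z)" "\<And>z. z > 0 \<Longrightarrow> z < f2 (f1 z)"
  shows "\<exists>a>0. eventually (\<lambda>t. a \<le> x t) at_top"
    and "\<exists>b>0. eventually (\<lambda>t. b \<le> y t) at_top"
proof -
  have "eventually (\<lambda>t. 0 \<le> t \<and> 0 \<le> h1 t \<and> 0 \<le> h2 t) at_top"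
    using eq1.delay eq2.delay eventually_ge_at_top[of 0]
    by (auto simp: delay_function_def filterlim_at_top eventually_conj_iff)
  then obtain T where T: "T \<ge> 0" "\<And>t. t \<ge> T \<Longrightarrow> 0 \<le> h1 t" "\<And>t. t \<ge> T \<Longrightarrow> 0 \<le> h2 t"
    unfolding eventually_at_top_linorder by (metis order_refl)
  obtain u where u: "u \<in> {0..T}" "\<And>t. t \<in> {0..T} \<Longrightarrow> x u \<le> x t"
    using continuous_attains_inf[of "{0..T}" x] eq1.x_cont[of T] T by auto
  obtain v where v: "v \<in> {0..T}" "\<And>t. t \<in> {0..T} \<Longrightarrow> y v \<le> y t"
    using continuous_attains_inf[of "{0..T}" y] eq2.x_cont[of T] T by auto
  \<comment> \<open>Half of a positive minimum lies strictly below all values on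
    \<open>{0..T}\<close>; the minimum is positive by \<open>x_pos\<close>.\<close>
  define a0 where "a0 = x u / 2"
  define b0 where "b0 = y v / 2"
  have pos: "a0 > 0" "b0 > 0"
    using u v eq1.x_pos[OF x0] eq2.x_pos[OF y0] by (auto simp: a0_def b0_def)
  have init: "a0 < x t" "b0 < y t" if "0 \<le> t" "t \<le> T" for t
    using u(2)[of t] v(2)[of t] that pos by (auto simp: a0_def b0_def)
  have fpos: "f1 b0 > 0" "f2 a0 > 0"
    using eq1.feedback eq2.feedback pos by (auto simp: feedback_function_def)
  define a where "a = min a0 (f1 b0)"
  define b where "b = min b0 (f2 a0)"
  have ab: "a \<le> f1 b" "b \<le> f2 a" "a > 0" "b > 0"
    using assms(1)[of a0] assms(2)[of b0] pos fpos by (auto simp: a_def b_def min_def)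
  define w where "w = (\<lambda>t. min (x t - a) (y t - b))"
  have w: "w t > 0" if "t \<ge> T" for t
  proof (rule continuous_induction_pos[OF _ _ _ that])
    show "continuous_on {T..} w"
      unfolding w_def using T
      by (intro continuous_intros continuous_on_subset[OF eq1.x_cont_atLeast]
          continuous_on_subset[OF eq2.x_cont_atLeast]) auto
    show "w T > 0"
      using init[of T] T by (auto simp: w_def a_def b_def)
    fix q :: real assume q: "T < q" and less: "\<And>t. T \<le> t \<Longrightarrow> t < q \<Longrightarrow> 0 < w t"
    have le: "a < x s" "b < y s" if "0 \<le> s" "s < q" for s
      using less[of s] init[of s] that by (cases "s \<ge> T"; force simp: w_def a_def b_def)+
    have "a < x q"
    proof (rule eq1.barrier_below[of T q a b])
      fix t s assume "T \<le> t" "t < q" "h1 t \<le> s" "s \<le> t"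
      then show "b \<le> y s" using T(2)[of t] le(2)[of s] by auto
    qed (use q ab le T in auto)
    moreover have "b < y q"
    proof (rule eq2.barrier_below[of T q b a])
      fix t s assume "T \<le> t" "t < q" "h2 t \<le> s" "s \<le> t"
      then show "a \<le> x s" using T(3)[of t] le(1)[of s] by auto
    qed (use q ab le T in auto)
    ultimately show "w q > 0" by (simp add: w_def)
  qed
  show "\<exists>a>0. eventually (\<lambda>t. a \<le> x t) at_top"
    using w ab by (intro exI[of _ a] conjI eventually_at_top_linorderI[of T])
      (auto simp: w_def intro: less_imp_le)
  show "\<exists>b>0. eventually (\<lambda>t. b \<le> y t) at_top"
    using w ab by (intro exI[of _ b] conjI eventually_at_top_linorderI[of T])
      (auto simp: w_def intro: less_imp_le)
qed

lemma x_tendsto_0: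
  assumes "\<And>z. z > 0 \<Longrightarrow> f1 (f2 z) < z" "\<And>z. z > 0 \<Longrightarrow> f2 (f1 z) < z"
  shows "(x \<longlongrightarrow> 0) at_top"
proof -
  obtain a0 b0 where bounded: "a0 > 0" "eventually (\<lambda>t. x t \<le> a0) at_top"
    "b0 > 0" "eventually (\<lambda>t. y t \<le> b0) at_top"
    using eventually_bounded_above[OF assms] by blast
  have small: "eventually (\<lambda>t. x t \<le> c) at_top" if "c > 0" for c
  proof (rule upper_bounds_shrink[where P = "\<lambda>c. eventually (\<lambda>t. x t \<le> c) at_top",
        OF composition_continuous assms(1) _ bounded(2,1) _ that])
    fix a c assume a: "a > 0" "eventually (\<lambda>t. x t \<le> a) at_top" and "f1 (f2 a) < c"
    have f2a: "f2 a \<ge> 0" using a(1) by (intro feedback_function_nonneg[OF eq2.feedback]) simp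
    \<comment> \<open>Each equation passes a bound on only with some slack, so \<open>b\<close> is
      inserted strictly above \<open>f2 a\<close> while \<open>f1 b\<close> stays below
      \<open>c\<close>.\<close>
    obtain b where b: "f2 a < b" "f1 b < c"
      using continuous_less_right[of f1 "f2 a" c] eq1.feedback f2a \<open>f1 (f2 a) < c\<close>
      by (auto simp: feedback_function_def)
    have "eventually (\<lambda>t. y t \<le> b) at_top"
      by (rule eq2.eventually_x_le[OF a(2) _ b(1) bounded(4)]) (use a in simp)
    then show "eventually (\<lambda>t. x t \<le> c) at_top"
      by (rule eq1.eventually_x_le[OF _ _ b(2) bounded(2)]) (use b f2a in simp)
  qed (auto elim: eventually_mono)
  show ?thesis
  proof (rule order_tendstoI)
    fix c :: real assume "c > 0"
    then show "eventually (\<lambda>t. x t < c) at_top"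
      using small[of "c / 2"] by (auto elim!: eventually_mono)
  next
    fix c :: real assume "c < 0"
    then show "eventually (\<lambda>t. c < x t) at_top"
      using eq1.x_nonneg by (intro eventually_at_top_linorderI[of 0]) (auto intro: less_le_trans)
  qed
qed

lemma x_tendsto_infinity:
  assumes "\<And>z. z > 0 \<Longrightarrow> z < f1 (f2 z)" "\<And>z. z > 0 \<Longrightarrow> z < f2 (f1 z)"
  shows "filterlim x at_top at_top"
proof -
  obtain a0 b0 where bounded: "a0 > 0" "eventually (\<lambda>t. a0 \<le> x t) at_top"
    "b0 > 0" "eventually (\<lambda>t. b0 \<le> y t) at_top"
    using eventually_bounded_below[OF assms] by blast
  have "eventually (\<lambda>t. c \<le> x t) at_top" for c
  proof (rule lower_bounds_grow[where P = "\<lambda>c. eventually (\<lambda>t. c \<le> x t) at_top",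
        OF composition_continuous assms(1) _ bounded(2,1)])
    fix a c assume a: "a > 0" "eventually (\<lambda>t. a \<le> x t) at_top" and "c < f1 (f2 a)"
    have f2a: "f2 a > 0" using a(1) eq2.feedback by (simp add: feedback_function_def)
    \<comment> \<open>The slack is now taken below \<open>f2 a\<close>, which is positive and so
      leaves room for a positive \<open>b\<close>.\<close>
    obtain b where b: "0 < b" "b < f2 a" "c < f1 b"
      using continuous_greater_left[of f1 "f2 a" c] eq1.feedback f2a \<open>c < f1 (f2 a)\<close>
      by (auto simp: feedback_function_def)
    have "eventually (\<lambda>t. b \<le> y t) at_top"
      by (rule eq2.eventually_x_ge[OF a(2) _ b(2) bounded(3,4)]) (use a in simp)
    then show "eventually (\<lambda>t. c \<le> x t) at_top"
      by (rule eq1.eventually_x_ge[OF _ _ b(3) bounded(1,2)]) (use b in simp)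
  qed (auto elim: eventually_mono)
  then show ?thesis by (simp add: filterlim_at_top)
qed

end

section \<open>The extended inverse\<close>

lemma ext_inverse_apply:
  assumes "feedback_function f" "0 \<le> w"
  shows "ext_inverse f (f w) = ereal w"
proof -
  have "inj_on f {0..}"
    using assms by (auto simp: feedback_function_def intro: strict_mono_on_imp_inj_on)
  then show ?thesis
    using assms feedback_function_mono[of f 0 w] by (auto simp: ext_inverse_def the_inv_into_f_f)
qed

text \<open>By the intermediate value theorem a point outside the range that is not below
  \<open>f 0\<close> lies above every value of \<open>f\<close>.\<close>

lemma ext_inverse_cases:
  assumes "feedback_function f"
  obtains "z < f 0" "ext_inverse f z = 0" | w where "0 \<le> w" "z = f w"
  | "\<And>u. 0 \<le> u \<Longrightarrow> f u < z" "ext_inverse f z = \<infinity>"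
proof (cases "z < f 0 \<or> z \<in> f ` {0..}")
  case True
  then show thesis using that(1,2) by (auto simp: ext_inverse_def)
next
  case False
  have "f u < z" if u: "0 \<le> u" for u
  proof (rule ccontr)
    assume "\<not> f u < z"
    moreover have "continuous_on {0..u} f"
      using assms by (auto simp: feedback_function_def intro: continuous_on_subset)
    ultimately obtain v where "0 \<le> v" "f v = z"
      using IVT'[of f 0 z u] False u by auto
    with False show False by auto
  qed
  then show thesis using False by (intro that(3)) (auto simp: ext_inverse_def)
qed

text \<open>The second inequality is the hypothesis at the point \<open>f1 z\<close>, where the
  inverse is \<open>z\<close>. For the first, the value 0 of the inverse is impossible as
  \<open>f2 z \<ge> 0\<close>, and a point above the range exceeds \<open>f1 (f2 z)\<close>
  anyway.\<close>

lemma less_ext_inverseD: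
  assumes f1: "feedback_function f1" and f2: "feedback_function f2"
    and less: "\<forall>z>0. ereal (f2 z) < ext_inverse f1 z" and "z > 0"
  shows "f1 (f2 z) < z" "f2 (f1 z) < z"
proof -
  have f2z: "f2 z \<ge> 0" using feedback_function_nonneg[OF f2] \<open>z > 0\<close> by simp
  show "f1 (f2 z) < z"
  proof (rule ext_inverse_cases[OF f1, of z])
    assume "ext_inverse f1 z = 0"
    then show ?thesis using less \<open>z > 0\<close> f2z by fastforce
  next
    fix w assume w: "0 \<le> w" "z = f1 w"
    then have "f2 z < w" using less \<open>z > 0\<close> ext_inverse_apply[OF f1] by fastforce
    then show ?thesis using feedback_function_strict_mono[OF f1 f2z] w by simp
  qed (use f2z in blast)
  have "f1 z > 0" using f1 \<open>z > 0\<close> by (simp add: feedback_function_def)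
  then show "f2 (f1 z) < z"
    using less ext_inverse_apply[OF f1, of z] \<open>z > 0\<close> by fastforce
qed

text \<open>The exceptional cases exchange their roles: an infinite inverse is impossible, and below
  the range \<open>z < f1 0 \<le> f1 (f2 z)\<close>.\<close>

lemma greater_ext_inverseD:
  assumes f1: "feedback_function f1" and f2: "feedback_function f2"
    and less: "\<forall>z>0. ereal (f2 z) > ext_inverse f1 z" and "z > 0"
  shows "z < f1 (f2 z)" "z < f2 (f1 z)"
proof -
  have f2z: "f2 z \<ge> 0" using feedback_function_nonneg[OF f2] \<open>z > 0\<close> by simp
  show "z < f1 (f2 z)"
  proof (rule ext_inverse_cases[OF f1, of z])
    assume "z < f1 0"
    then show ?thesis using feedback_function_mono[OF f1 _ f2z] by simp
  next
    fix w assume w: "0 \<le> w" "z = f1 w"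
    then have "w < f2 z" using less \<open>z > 0\<close> ext_inverse_apply[OF f1] by fastforce
    then show ?thesis using feedback_function_strict_mono[OF f1] w by simp
  next
    assume "ext_inverse f1 z = \<infinity>"
    then show ?thesis using less \<open>z > 0\<close> by fastforce
  qed
  have "f1 z > 0" using f1 \<open>z > 0\<close> by (simp add: feedback_function_def)
  then show "z < f2 (f1 z)"
    using less ext_inverse_apply[OF f1, of z] \<open>z > 0\<close> by fastforce
qed

section \<open>Solutions of the initial value problem\<close>

lemma solution_continuous:
  fixes x \<phi> :: "real \<Rightarrow> real"
  assumes x: "locally_abs_continuous x" and \<phi>: "continuous_on {..0} \<phi>" "\<And>t. t \<le> 0 \<Longrightarrow> x t = \<phi> t"
  shows "continuous_on UNIV x"
proof -
  have left: "continuous_on {..0} x"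
    using \<phi> by (metis atMost_iff continuous_on_cong)
  have "isCont x t" for t
  proof -
    define T where "T = \<bar>t\<bar> + 1"
    have "continuous_on {0..T} x"
      by (rule abs_continuous_imp_continuous_on) (use x in \<open>auto simp: locally_abs_continuous_def T_def\<close>)
    then have "continuous_on ({..0} \<union> {0..T}) x"
      by (intro continuous_on_closed_Un left) auto
    then show ?thesis
      \<comment> \<open>The initial part and the solution are glued at 0, and \<open>t\<close> is
        interior to the union as \<open>t < T\<close>.\<close>
      by (rule continuous_on_interior) (auto simp: T_def interior_open intro!: interiorI[of "{..<T}"])
  qed
  then show ?thesis by (simp add: continuous_at_imp_continuous_on)
qed

lemma PG_solution_coupled_system:
  assumes "feedback_function f1" "feedback_function f2"
    and "delay_function h1" "delay_function h2"
    and "delay_distribution h1 R1" "delay_distribution h2 R2"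
    and "rate_function r1" "rate_function r2"
    and \<phi>: "initial_function \<phi>" and \<psi>: "initial_function \<psi>"
    and "gain_function G1" "gain_function G2"
    and sol: "PG_solution r1 r2 G1 G2 f1 f2 h1 h2 R1 R2 \<phi> \<psi> x y"
  shows "coupled_system r1 r2 G1 G2 f1 f2 h1 h2 x y R1 R2"
proof -
  have init: "x t = \<phi> t" "y t = \<psi> t" if "t \<le> 0" for t
    using sol that by (auto simp: PG_solution_def)
  have pos: "\<phi> t \<ge> 0" "\<psi> t \<ge> 0" if "t \<le> 0" for t
    using \<phi> \<psi> that by (cases "t = 0"; auto simp: initial_function_def)+
  have nonneg: "x t \<ge> 0" "y t \<ge> 0" for t
    using sol init[of t] pos[of t] by (cases "t \<ge> 0"; auto simp: PG_solution_def)+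
  have cont: "continuous_on UNIV x" "continuous_on UNIV y"
    using sol \<phi> \<psi> init
    by (auto simp: PG_solution_def initial_function_def intro: solution_continuous)
  have "AE t in lebesgue. t \<in> {0..} \<longrightarrow>
        (x has_real_derivative
           r1 t * G1 (x t) * (stieltjes_integral (R1 t) (h1 t) t (\<lambda>s. f1 (y s)) - x t)) (at t) \<and>
        (y has_real_derivative
           r2 t * G2 (y t) * (stieltjes_integral (R2 t) (h2 t) t (\<lambda>s. f2 (x s)) - y t)) (at t)"
    using sol unfolding PG_solution_def by (subst (asm) AE_restrict_space_iff) simp_all
  then have deriv: "AE t in lebesgue. t \<ge> 0 \<longrightarrow> (x has_real_derivative
           r1 t * G1 (x t) * (stieltjes_integral (R1 t) (h1 t) t (\<lambda>s. f1 (y s)) - x t)) (at t)"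
    "AE t in lebesgue. t \<ge> 0 \<longrightarrow> (y has_real_derivative
           r2 t * G2 (y t) * (stieltjes_integral (R2 t) (h2 t) t (\<lambda>s. f2 (x s)) - y t)) (at t)"
    by (auto elim: eventually_mono)
  have ac: "locally_abs_continuous x" "locally_abs_continuous y"
    using sol by (auto simp: PG_solution_def)
  have "x ` {..0} = \<phi> ` {..0}" "y ` {..0} = \<psi> ` {..0}"
    using init by (auto intro: image_cong)
  then have "bounded (x ` {..0})" "bounded (y ` {..0})" "x 0 > 0" "y 0 > 0"
    using \<phi> \<psi> init by (auto simp: initial_function_def)
  then show ?thesis
    using assms nonneg cont deriv ac
    by (intro coupled_system.intro delayed_equation.intro coupled_system_axioms.intro)
qed

theorem theorem3p16:
  fixes f1 f2 G1 G2 h1 h2 r1 r2 \<phi> \<psi> :: "real \<Rightarrow> real"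
    and R1 R2 :: "real \<Rightarrow> real \<Rightarrow> real"
  assumes "feedback_function f1" and "feedback_function f2"
    and "delay_function h1" and "delay_function h2"
    and "delay_distribution h1 R1" and "delay_distribution h2 R2"
    and "rate_function r1" and "rate_function r2"
    and "initial_function \<phi>" and "initial_function \<psi>"
    and "gain_function G1" and "gain_function G2"
  shows "((\<forall>x>0. ereal (f2 x) < ext_inverse f1 x) \<longrightarrow>
           (\<forall>x y. PG_solution r1 r2 G1 G2 f1 f2 h1 h2 R1 R2 \<phi> \<psi> x y \<longrightarrow>
              (x \<longlongrightarrow> 0) at_top \<and> (y \<longlongrightarrow> 0) at_top)) \<and>
         ((\<forall>x>0. ereal (f2 x) > ext_inverse f1 x) \<longrightarrow>
           (\<forall>x y. PG_solution r1 r2 G1 G2 f1 f2 h1 h2 R1 R2 \<phi> \<psi> x y \<longrightarrow>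
              filterlim x at_top at_top \<and> filterlim y at_top at_top))"
proof (rule conjI; intro impI allI)
  fix x y assume less: "\<forall>x>0. ereal (f2 x) < ext_inverse f1 x"
    and "PG_solution r1 r2 G1 G2 f1 f2 h1 h2 R1 R2 \<phi> \<psi> x y"
  note c = PG_solution_coupled_system[OF assms this(2)]
  note less = less_ext_inverseD[OF assms(1,2) less]
  show "(x \<longlongrightarrow> 0) at_top \<and> (y \<longlongrightarrow> 0) at_top"
    \<comment> \<open>Exchanging the components also exchanges the two composition
      inequalities.\<close>
    using coupled_system.x_tendsto_0[OF c less]
      coupled_system.x_tendsto_0[OF coupled_system.swap[OF c] less(2,1)] by simp
next
  fix x y assume greater: "\<forall>x>0. ereal (f2 x) > ext_inverse f1 x"
    and "PG_solution r1 r2 G1 G2 f1 f2 h1 h2 R1 R2 \<phi> \<psi> x y"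
  note c = PG_solution_coupled_system[OF assms this(2)]
  note greater = greater_ext_inverseD[OF assms(1,2) greater]
  show "filterlim x at_top at_top \<and> filterlim y at_top at_top"
    using coupled_system.x_tendsto_infinity[OF c greater]
      coupled_system.x_tendsto_infinity[OF coupled_system.swap[OF c] greater(2,1)] by simp
qed

end
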